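(* Let $\mathcal{F}\subseteq\mathcal{B}^{<\omega}(\mathbb{N})$ be a hereditary family of finite disjoint collections and let $\mathcal{D}$ be an infinite disjoint collection. Case 1: if $\mathcal{F}\cap\mathcal{B}^{<\omega}(\mathcal{D})$ is not pointwise closed, then there exists an infinite disjoint collection $\mathcal{D}_1<\mathcal{D}$ with $\mathcal{B}^{<\omega}(\mathcal{D}_1)\subseteq\mathcal{F}$. Case 2: if $\mathcal{F}\cap\mathcal{B}^{<\omega}(\mathcal{D})$ is pointwise closed, then $\xi^{\mathcal{F}}_{\mathcal{D}}:=\sup\{s_{\mathcal{D}_1}(\mathcal{F}):\mathcal{D}_1<\mathcal{D}\}$ is a countable ordinal, and for every countable ordinal $\xi$: (i) if $\xi+1<\xi^{\mathcal{F}}_{\mathcal{D}}$, there exists $\mathcal{D}_2<\mathcal{D}$ with $\mathcal{B}^\xi\cap\mathcal{B}^{<\omega}(\mathcal{D}_2)\subseteq\mathcal{F}$; (ii) if $\xi+1>\xi^{\mathcal{F}}_{\mathcal{D}}$, then for every $\mathcal{D}_1<\mathcal{D}$ there exists $\mathcal{D}_2<\mathcal{D}_1$ with $\mathcal{B}^\xi\cap\mathcal{B}^{<\omega}(\mathcal{D}_2)\subseteq\mathcal{B}^{<\omega}(\mathbb{N})\setminus\mathcal{F}$ (equivalently $\mathcal{F}\cap\mathcal{B}^{<\omega}(\mathcal{D}_2)\subseteq(\mathcal{B}^\xi)^*\setminus\mathcal{B}^\xi$); (iii) if $\xi+1=\xi^{\mathcal{F}}_{\mathcal{D}}$, there exists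 $\mathcal{D}_2<\mathcal{D}$ such that either $\mathcal{B}^\xi\cap\mathcal{B}^{<\omega}(\mathcal{D}_2)\subseteq\mathcal{F}$ or $\mathcal{B}^\xi\cap\mathcal{B}^{<\omega}(\mathcal{D}_2)\subseteq\mathcal{B}^{<\omega}(\mathbb{N})\setminus\mathcal{F}$.
   Context: $\mathbb{N}=\{1,2,\dots\}$. For nonempty $s,t\subseteq\mathbb{N}$ with $s$ finite, $s<t$ means $\max s<\min t$. A finite disjoint collection is a tuple $\mathbf{s}=(s_1,\dots,s_k)$, $k\ge0$ (the empty collection $\emptyset$ for $k=0$), of nonempty finite subsets of $\mathbb{N}$ with $s_1<\dots<s_k$; an infinite disjoint collection is a sequence $(s_n)_{n\in\mathbb{N}}$ of nonempty finite subsets with $s_n<s_{n+1}$. Collections are identified with the set of their members. $\mathcal{B}^{<\omega}(\mathbb{N})$ is the set of finite disjoint collections. $FU(\mathcal{D})$ is the set of unions of finitely many (at least one) members of $\mathcal{D}$. For infinite disjoint collections, $\mathcal{D}_1<\mathcal{D}$ means $\mathcal{D}_1\subseteq FU(\mathcal{D})$. $\mathcal{B}^{<\omega}(\mathcal{D})$ is the set of finite disjoint collections with all members in $FU(\mathcal{D})$ (including $\emptyset$). $\mathbf{t}\propto\mathbf{s}$ means $\mathbf{t}$ is an initial segment of $\mathbf{s}$. For $\mathcal{G}\subseteq\mathcal{B}^{<\omega}(\mathbb{N})$: $\mathcal{G}^*=\{\mathbf{t}:\mathbf{t}\propto\mathbf{s}\text{ for some }\mathbf{s}\in\mathcal{G}\}\cup\{\emptyset\}$;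 $\mathcal{G}_*=\{\mathbf{t}\in\mathcal{B}^{<\omega}(\mathbb{N}):\mathbf{t}\subseteq FU(\mathbf{s})\text{ for some }\mathbf{s}\in\mathcal{G}\}\cup\{\emptyset\}$; $\mathcal{G}$ is hereditary if $\mathcal{G}_*=\mathcal{G}$. Pointwise topology: identify each collection of finite subsets of $\mathbb{N}$ with its characteristic function in $\{0,1\}^{[\mathbb{N}]^{<\omega}}$; a family is pointwise closed if the set of these characteristic functions is closed in the product topology. Strong block Cantor–Bendixson index: for a hereditary $\mathcal{G}$ and infinite disjoint collection $\mathcal{D}$, let $(\mathcal{G})^0_{\mathcal{D}}=\mathcal{G}\cap\mathcal{B}^{<\omega}(\mathcal{D})$; $(\mathcal{G})^1_{\mathcal{D}}=\{\mathbf{s}\in\mathcal{G}\cap\mathcal{B}^{<\omega}(\mathcal{D}):$ the set $\{t\in FU(\mathcal{D}):\mathbf{s}\cup\{t\}\notin\mathcal{G}\}$ contains no infinite disjoint collection$\}$ (here $\mathbf{s}\cup\{t\}$ is the collection obtained by adjoining $t$ as a member); $(\mathcal{G})^{\zeta+1}_{\mathcal{D}}=((\mathcal{G})^\zeta_{\mathcal{D}})^1_{\mathcal{D}}$; $(\mathcal{G})^\xi_{\mathcal{D}}=\bigcap_{\beta<\xi}(\mathcal{G})^\beta_{\mathcal{D}}$ for limit $\xi$. $s_{\mathcal{D}}(\mathcal{G})$ is the least countable ordinal $\xi$ with $(\mathcal{G})^\xi_{\mathcal{D}}=\emptyset$. Schreier families: fix, for every countable limit ordinal $\lambda>0$, a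 strictly increasing sequence $(\lambda_n)$ of successor ordinals $<\lambda$ with supremum $\lambda$. Define $\mathcal{A}_\xi\subseteq[\mathbb{N}]^{<\omega}$ recursively: $\mathcal{A}_0=\{\emptyset\}$; $\mathcal{A}_{\zeta+1}=\{\{n\}\cup s_1:s_1\in\mathcal{A}_\zeta,\{n\}<s_1\}$ ($\{n\}<\emptyset$ vacuous); $\mathcal{A}_{\omega^{\beta+1}}=\{s_1\cup\dots\cup s_n:s_1<\dots<s_n\in\mathcal{A}_{\omega^\beta},n=\min s_1\}$; for limit $\lambda>0$, $\mathcal{A}_{\omega^\lambda}=\{s:s\in\mathcal{A}_{\omega^{\lambda_n}},n=\min s\}$; for limit $\xi$ with $\omega^a<\xi<\omega^{a+1}$, $\xi=p\omega^a+\sum_{i=1}^m p_i\omega^{a_i}$ ($m\ge0$, $p,p_i\ge1$, $a>a_1>\dots>a_m>0$, $p>1$ or $m\ge1$): $\mathcal{A}_\xi=\{s_0\cup\dots\cup s_m:s_m<\dots<s_0,\ s_0$ a union of $p$ successive members of $\mathcal{A}_{\omega^a}$, each $s_i$ ($1\le i\le m$) a union $s^i_1\cup\dots\cup s^i_{p_i}$ with $s^i_1<\dots<s^i_{p_i}\in\mathcal{A}_{\omega^{a_i}}\}$. Block Schreier families: $\mathcal{B}^0=\{\emptyset\}$; for $\xi\ge1$, $\mathcal{B}^\xi=\{(s_1,\dots,s_k):k\ge1,\ s_1<\dots<s_k,\ \{\min s_1,\dots,\min s_k\}\in\mathcal{A}_\xi\}$. *)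

theory Defs
  imports "HOL-Analysis.Analysis" "HOL-Library.Countable_Set_Type"
begin

unbundle cardinal_syntax

section \<open>Countable ordinals\<close>

text \<open>The type of all countable ordinals is \<open>\<omega>\<^sub>1\<close>, realised as the first uncountable cardinal
  (a well-order) of the library. The lemmas \<open>countable_lessThan\<close> and \<open>uncountable_UNIV\<close> below
  characterise this well-ordered type up to isomorphism.\<close>

typedef countable_ordinal = "Field (cardSuc natLeq)"
proof -
  have "infinite (Field (cardSuc natLeq))"
    using cardSuc_finite[OF natLeq_Card_order] Field_natLeq infinite_UNIV_nat by metis
  thus ?thesis by (metis finite.emptyI ex_in_conv)
qed

lemma Well_order_cardSuc_natLeq: "Well_order (cardSuc natLeq)"
  using cardSuc_Card_order[OF natLeq_Card_order] card_order_on_well_order_on by blast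

instantiation countable_ordinal :: linorder
begin

definition less_eq_countable_ordinal :: "countable_ordinal \<Rightarrow> countable_ordinal \<Rightarrow> bool" where
  "x \<le> y \<longleftrightarrow> (Rep_countable_ordinal x, Rep_countable_ordinal y) \<in> cardSuc natLeq"

definition less_countable_ordinal :: "countable_ordinal \<Rightarrow> countable_ordinal \<Rightarrow> bool" where
  "(x :: countable_ordinal) < y \<longleftrightarrow> x \<le> y \<and> x \<noteq> y"

instance
proof -
  let ?r = "cardSuc natLeq"
  have lin: "refl_on (Field ?r) ?r" "trans ?r" "antisym ?r" "total_on (Field ?r) ?r"
    using Well_order_cardSuc_natLeq
    by (auto simp: well_order_on_def linear_order_on_def partial_order_on_def preorder_on_def)
  have anti: "x = y" if "x \<le> y" "y \<le> x" for x y :: countable_ordinal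
    using that lin(3) unfolding less_eq_countable_ordinal_def
    by (meson antisymD Rep_countable_ordinal_inject)
  have refl: "x \<le> x" for x :: countable_ordinal
    using lin(1) Rep_countable_ordinal unfolding less_eq_countable_ordinal_def
    by (meson refl_onD)
  show "OFCLASS(countable_ordinal, linorder_class)"
  proof
    fix x y z :: countable_ordinal
    show "x < y \<longleftrightarrow> x \<le> y \<and> \<not> y \<le> x"
      using anti refl unfolding less_countable_ordinal_def by metis
    show "x \<le> x" by (rule refl)
    show "x \<le> z" if "x \<le> y" "y \<le> z"
      using that lin(2) unfolding less_eq_countable_ordinal_def by (meson transD)
    show "x = y" if "x \<le> y" "y \<le> x" using anti that .
    show "x \<le> y \<or> y \<le> x"
      using lin(4) refl Rep_countable_ordinal unfolding less_eq_countable_ordinal_def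
      by (metis total_on_def)
  qed
qed

end

instance countable_ordinal :: wellorder
proof
  fix P :: "countable_ordinal \<Rightarrow> bool" and a
  assume step: "\<And>x. (\<And>y. y < x \<Longrightarrow> P y) \<Longrightarrow> P x"
  have "wf (cardSuc natLeq - Id)"
    using Well_order_cardSuc_natLeq by (simp add: well_order_on_def)
  hence "wf (inv_image (cardSuc natLeq - Id) Rep_countable_ordinal)"
    by (rule wf_inv_image)
  moreover have "inv_image (cardSuc natLeq - Id) Rep_countable_ordinal = {(x, y). x < y}"
    by (auto simp: inv_image_def less_countable_ordinal_def less_eq_countable_ordinal_def
        Rep_countable_ordinal_inject)
  ultimately have "wf {(x::countable_ordinal, y). x < y}" by simp
  thus "P a" by (induction a rule: wf_induct_rule) (use step in auto)
qed

lemma countable_lessThan: "countable {..< x :: countable_ordinal}"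
proof -
  have "|underS (cardSuc natLeq) (Rep_countable_ordinal x)| <o cardSuc natLeq"
    using card_of_underS[OF cardSuc_Card_order[OF natLeq_Card_order] Rep_countable_ordinal] .
  hence "|underS (cardSuc natLeq) (Rep_countable_ordinal x)| \<le>o natLeq"
    using cardSuc_ordLeq_ordLess[OF natLeq_Card_order card_of_Card_order] by blast
  hence "countable (underS (cardSuc natLeq) (Rep_countable_ordinal x))"
    by (simp add: countable_card_le_natLeq)
  moreover have "Rep_countable_ordinal ` {..<x} \<subseteq> underS (cardSuc natLeq) (Rep_countable_ordinal x)"
    by (auto simp: underS_def less_countable_ordinal_def less_eq_countable_ordinal_def
        Rep_countable_ordinal_inject)
  ultimately have "countable (Rep_countable_ordinal ` {..<x})"
    by (meson countable_subset)
  thus ?thesis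
    by (rule countable_image_inj_on) (simp add: inj_on_def Rep_countable_ordinal_inject)
qed

lemma uncountable_UNIV: "uncountable (UNIV :: countable_ordinal set)"
proof
  assume "countable (UNIV :: countable_ordinal set)"
  hence "countable (range Rep_countable_ordinal)" by (rule countable_image)
  moreover have "range Rep_countable_ordinal = Field (cardSuc natLeq)"
    using type_definition.Rep_range[OF type_definition_countable_ordinal] .
  ultimately have "|Field (cardSuc natLeq)| \<le>o natLeq"
    by (simp add: countable_card_le_natLeq)
  moreover have "|Field (cardSuc natLeq)| =o cardSuc natLeq"
    by (rule card_of_Field_ordIso[OF cardSuc_Card_order[OF natLeq_Card_order]])
  ultimately have "cardSuc natLeq \<le>o natLeq"
    using ordIso_ordLeq_trans ordIso_symmetric by blast
  thus False
    using cardSuc_greater[OF natLeq_Card_order] not_ordLess_ordLeq by blast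
qed

unbundle no cardinal_syntax

lemma countable_imp_bounded:
  assumes "countable (X :: countable_ordinal set)"
  shows "\<exists>y. \<forall>x\<in>X. x < y"
proof (rule ccontr)
  assume "\<not> ?thesis"
  hence "UNIV = (\<Union>x\<in>X. insert x {..<x})" by (auto simp: not_less le_less)
  moreover have "countable (\<Union>x\<in>X. insert x {..<x})"
    using assms countable_lessThan by blast
  ultimately show False using uncountable_UNIV by simp
qed

instantiation countable_ordinal :: "{conditionally_complete_linorder, zero}"
begin

definition inf_countable_ordinal :: "countable_ordinal \<Rightarrow> countable_ordinal \<Rightarrow> countable_ordinal"
  where "inf_countable_ordinal = min"

definition sup_countable_ordinal :: "countable_ordinal \<Rightarrow> countable_ordinal \<Rightarrow> countable_ordinal"
  where "sup_countable_ordinal = max"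

definition Inf_countable_ordinal :: "countable_ordinal set \<Rightarrow> countable_ordinal"
  where "Inf X = (LEAST x :: countable_ordinal. x \<in> X)"

definition Sup_countable_ordinal :: "countable_ordinal set \<Rightarrow> countable_ordinal"
  where "Sup X = (LEAST y :: countable_ordinal. \<forall>x\<in>X. x \<le> y)"

definition zero_countable_ordinal :: countable_ordinal
  where "0 = (LEAST x :: countable_ordinal. True)"

instance
proof
  fix x z :: countable_ordinal and X :: "countable_ordinal set"
  show "Inf X \<le> x" if "x \<in> X" "bdd_below X"
    unfolding Inf_countable_ordinal_def using that(1) by (rule Least_le)
  show "z \<le> Inf X" if "X \<noteq> {}" "\<And>x. x \<in> X \<Longrightarrow> z \<le> x"
    unfolding Inf_countable_ordinal_def using that by (metis LeastI ex_in_conv)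
  show "x \<le> Sup X" if "x \<in> X" "bdd_above X"
  proof -
    from that(2) obtain b where "\<forall>x\<in>X. x \<le> b" by (auto simp: bdd_above_def)
    hence "\<forall>x\<in>X. x \<le> Sup X" unfolding Sup_countable_ordinal_def by (rule LeastI)
    thus ?thesis using that(1) by blast
  qed
  show "Sup X \<le> z" if "X \<noteq> {}" "\<And>x. x \<in> X \<Longrightarrow> x \<le> z"
    unfolding Sup_countable_ordinal_def by (rule Least_le) (use that in blast)
qed (auto simp: inf_countable_ordinal_def sup_countable_ordinal_def)

end

lemma countable_ordinal_zero_le: "0 \<le> (x :: countable_ordinal)"
  unfolding zero_countable_ordinal_def by (rule Least_le) simp

definition osucc :: "countable_ordinal \<Rightarrow> countable_ordinal" where
  "osucc x = (LEAST y. x < y)"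

lemma less_osucc: "x < osucc x"
  unfolding osucc_def by (rule LeastI_ex) (use countable_imp_bounded[of "{x}"] in auto)

lemma osucc_le_iff: "osucc x \<le> y \<longleftrightarrow> x < y"
  using less_osucc[of x] unfolding osucc_def by (meson Least_le less_le_trans)

lemma less_osucc_iff: "x < osucc y \<longleftrightarrow> x \<le> y"
  using osucc_le_iff[of y x] by (meson not_less)

lemma osucc_inject: "osucc x = osucc y \<longleftrightarrow> x = y"
  by (metis less_osucc_iff order.antisym order.refl)

definition is_limit :: "countable_ordinal \<Rightarrow> bool" where
  "is_limit x \<longleftrightarrow> x \<noteq> 0 \<and> (\<forall>y. x \<noteq> osucc y)"

function transrec :: "'a \<Rightarrow> ('a \<Rightarrow> 'a) \<Rightarrow> ('a set \<Rightarrow> 'a) \<Rightarrow> countable_ordinal \<Rightarrow> 'a" where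
  "transrec z s l x =
     (if x = 0 then z
      else if \<exists>y. x = osucc y then s (transrec z s l (THE y. x = osucc y))
      else l (transrec z s l ` {..<x}))"
  by pat_completeness auto
termination
proof (relation "inv_image {(x, y). x < y} (\<lambda>(z, s, l, x). x)", goal_cases)
  case 1
  show ?case by (intro wf_inv_image wf)
next
  case (2 z s l x)
  then obtain y where "x = osucc y" by blast
  thus ?case by (simp add: osucc_inject less_osucc)
qed auto

declare transrec.simps [simp del]

lemma transrec_zero: "transrec z s l 0 = z"
  by (simp add: transrec.simps)

lemma transrec_osucc: "transrec z s l (osucc x) = s (transrec z s l x)"
proof -
  have "osucc x \<noteq> 0"
    using less_osucc[of x] countable_ordinal_zero_le[of x] by (metis not_less)
  thus ?thesis by (simp add: transrec.simps[of z s l "osucc x"] osucc_inject)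
qed

lemma transrec_limit: "is_limit x \<Longrightarrow> transrec z s l x = l (transrec z s l ` {..<x})"
  by (subst transrec.simps) (auto simp: is_limit_def)

definition oadd :: "countable_ordinal \<Rightarrow> countable_ordinal \<Rightarrow> countable_ordinal" where
  "oadd x = transrec x osucc Sup"

definition omult_nat :: "countable_ordinal \<Rightarrow> nat \<Rightarrow> countable_ordinal" where
  "omult_nat x n = ((\<lambda>y. oadd y x) ^^ n) 0"

definition omega_pow :: "countable_ordinal \<Rightarrow> countable_ordinal" where
  "omega_pow = transrec (osucc 0) (\<lambda>x. SUP n. omult_nat x n) Sup"

text \<open>\<open>cnf_value [(a\<^sub>0, p\<^sub>0), \<dots>, (a\<^sub>m, p\<^sub>m)]\<close> is the ordinal
  \<open>\<omega>\<^bsup>a\<^sub>0\<^esup> \<cdot> p\<^sub>0 + \<dots> + \<omega>\<^bsup>a\<^sub>m\<^esup> \<cdot> p\<^sub>m\<close>.\<close>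

definition cnf_value :: "(countable_ordinal \<times> nat) list \<Rightarrow> countable_ordinal" where
  "cnf_value aps = foldr (\<lambda>(a, p) x. oadd (omult_nat (omega_pow a) p) x) aps 0"

section \<open>Disjoint collections\<close>

text \<open>The ground set is \<open>{1, 2, \<dots>}\<close>. A collection is represented by the set of its members.\<close>

definition finsets :: "nat set set" where
  "finsets = {s. finite s \<and> s \<subseteq> {1..}}"

text \<open>For nonempty sets with finite \<open>s\<close> this is \<open>max s < min t\<close>; it is vacuous if \<open>t\<close> is empty.\<close>

definition set_less :: "nat set \<Rightarrow> nat set \<Rightarrow> bool" (infix \<open>\<lless>\<close> 50) where
  "s \<lless> t \<longleftrightarrow> (\<forall>m\<in>s. \<forall>n\<in>t. m < n)"

definition disjoint_tuple :: "nat set list \<Rightarrow> bool" where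
  "disjoint_tuple ss \<longleftrightarrow> set ss \<subseteq> finsets - {{}} \<and> sorted_wrt (\<lless>) ss"

definition fin_collections :: "nat set set set" where
  "fin_collections = {set ss | ss. disjoint_tuple ss}"

definition inf_collection :: "nat set set \<Rightarrow> bool" where
  "inf_collection D \<longleftrightarrow>
     (\<exists>s :: nat \<Rightarrow> nat set. (\<forall>n. s n \<in> finsets - {{}} \<and> s n \<lless> s (Suc n)) \<and> D = range s)"

definition FU :: "nat set set \<Rightarrow> nat set set" where
  "FU D = {\<Union>T | T. T \<subseteq> D \<and> finite T \<and> T \<noteq> {}}"

definition subcollection :: "nat set set \<Rightarrow> nat set set \<Rightarrow> bool" (infix \<open>\<sqsubset>\<close> 50) where
  "D1 \<sqsubset> D \<longleftrightarrow> inf_collection D1 \<and> inf_collection D \<and> D1 \<subseteq> FU D"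

definition fin_collections_in :: "nat set set \<Rightarrow> nat set set set" where
  "fin_collections_in D = {s \<in> fin_collections. s \<subseteq> FU D}"

definition initial_segment :: "nat set set \<Rightarrow> nat set set \<Rightarrow> bool" where
  "initial_segment t s \<longleftrightarrow> (\<exists>ss k. disjoint_tuple ss \<and> s = set ss \<and> t = set (take k ss))"

definition upper_star :: "nat set set set \<Rightarrow> nat set set set" where
  "upper_star G = {t. \<exists>s\<in>G. initial_segment t s} \<union> {{}}"

definition lower_star :: "nat set set set \<Rightarrow> nat set set set" where
  "lower_star G = {t \<in> fin_collections. \<exists>s\<in>G. t \<subseteq> FU s} \<union> {{}}"

definition hereditary :: "nat set set set \<Rightarrow> bool" where
  "hereditary G \<longleftrightarrow> lower_star G = G"

definition char_fun :: "nat set set \<Rightarrow> nat set \<Rightarrow> bool" where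
  "char_fun C = (\<lambda>s\<in>finsets. s \<in> C)"

definition pointwise_closed :: "nat set set set \<Rightarrow> bool" where
  "pointwise_closed G \<longleftrightarrow>
     closedin (product_topology (\<lambda>_. discrete_topology (UNIV :: bool set)) finsets) (char_fun ` G)"

section \<open>The strong block Cantor--Bendixson index\<close>

definition derived1 :: "nat set set \<Rightarrow> nat set set set \<Rightarrow> nat set set set" where
  "derived1 D G =
     {s \<in> G \<inter> fin_collections_in D.
        \<not> (\<exists>E. inf_collection E \<and> E \<subseteq> {t \<in> FU D. insert t s \<notin> G})}"

definition derived :: "nat set set \<Rightarrow> nat set set set \<Rightarrow> countable_ordinal \<Rightarrow> nat set set set" where
  "derived D G = transrec (G \<inter> fin_collections_in D) (derived1 D) Inter"

definition cb_index :: "nat set set \<Rightarrow> nat set set set \<Rightarrow> countable_ordinal" where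
  "cb_index D G = (LEAST \<xi>. derived D G \<xi> = {})"

definition sup_index :: "nat set set \<Rightarrow> nat set set set \<Rightarrow> countable_ordinal" where
  "sup_index D G = Sup {cb_index D1 G | D1. D1 \<sqsubset> D}"

section \<open>Schreier families\<close>

text \<open>\<open>L \<lambda> n\<close> with \<open>n \<ge> 1\<close> is the fixed sequence \<open>\<lambda>\<^sub>n\<close>; the value at \<open>n = 0\<close> is irrelevant.\<close>

definition ladder_system :: "(countable_ordinal \<Rightarrow> nat \<Rightarrow> countable_ordinal) \<Rightarrow> bool" where
  "ladder_system L \<longleftrightarrow>
     (\<forall>x. is_limit x \<longrightarrow>
        strict_mono_on {1..} (L x) \<and>
        (\<forall>n\<ge>1. L x n < x \<and> (\<exists>y. L x n = osucc y)) \<and>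
        (SUP n\<in>{1..}. L x n) = x)"

text \<open>\<open>schreier L \<xi> s\<close> means \<open>s \<in> \<A>\<^sub>\<xi>\<close>. The ordinals in the conclusions of the five rules are
  disjoint cases, and every rule refers only to families of smaller index, so this least
  fixed point is the recursively defined sequence of families. In rule \<open>cnf\<close>, the list \<open>aps\<close>
  holds the pairs \<open>(a, p), (a\<^sub>1, p\<^sub>1), \<dots>, (a\<^sub>m, p\<^sub>m)\<close> and \<open>tss ! i\<close> is the list of the \<open>p\<^sub>i\<close>
  successive members of \<open>\<A>\<close> of index \<open>\<omega>\<^bsup>a\<^sub>i\<^esup>\<close> whose union is \<open>s\<^sub>i\<close>. The premises on \<open>aps\<close> say that
  \<open>cnf_value aps\<close> is a limit ordinal that is not a power of \<open>\<omega>\<close>.\<close>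

inductive schreier ::
  "(countable_ordinal \<Rightarrow> nat \<Rightarrow> countable_ordinal) \<Rightarrow> countable_ordinal \<Rightarrow> nat set \<Rightarrow> bool"
  for L where
  zero: "schreier L 0 {}"
| succ: "\<lbrakk>schreier L \<zeta> s; n \<ge> 1; {n} \<lless> s\<rbrakk> \<Longrightarrow> schreier L (osucc \<zeta>) (insert n s)"
| omega_succ:
    "\<lbrakk>ss \<noteq> []; \<forall>s\<in>set ss. schreier L (omega_pow \<beta>) s; sorted_wrt (\<lless>) ss; length ss = Min (hd ss)\<rbrakk>
     \<Longrightarrow> schreier L (omega_pow (osucc \<beta>)) (\<Union>(set ss))"
| omega_limit:
    "\<lbrakk>is_limit x; s \<noteq> {}; schreier L (omega_pow (L x (Min s))) s\<rbrakk> \<Longrightarrow> schreier L (omega_pow x) s"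
| cnf:
    "\<lbrakk>aps \<noteq> []; sorted_wrt (>) (map fst aps); \<forall>(a, p)\<in>set aps. a > 0 \<and> p \<ge> 1;
      length aps > 1 \<or> snd (hd aps) > 1;
      length tss = length aps;
      \<forall>i<length aps. length (tss ! i) = snd (aps ! i) \<and> sorted_wrt (\<lless>) (tss ! i) \<and>
        (\<forall>t\<in>set (tss ! i). schreier L (omega_pow (fst (aps ! i))) t);
      sorted_wrt (\<lambda>s s'. s' \<lless> s) (map (\<lambda>ts. \<Union>(set ts)) tss)\<rbrakk>
     \<Longrightarrow> schreier L (cnf_value aps) (\<Union>ts\<in>set tss. \<Union>(set ts))"

definition block_schreier ::
  "(countable_ordinal \<Rightarrow> nat \<Rightarrow> countable_ordinal) \<Rightarrow> countable_ordinal \<Rightarrow> nat set set set" where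
  "block_schreier L \<xi> =
     (if \<xi> = 0 then {{}}
      else {s \<in> fin_collections. s \<noteq> {} \<and> schreier L \<xi> (Min ` s)})"

end

(* A family is uniform of rank xi when removing the first element n of its members leaves a uniform
   family of some rank r n < xi, where r n tends to xi; concatenating families adds the ranks, so the
   Cantor normal form shows that the Schreier family of index xi is uniform of rank xi. Induction on the
   rank, with Hindman's theorem (in Baumgartner's proof) and a fusion argument, gives a Ramsey theorem
   for the block families. The same induction shows that the empty collection survives xi derivations
   when F contains the block family on some infinite D, and does not survive xi + 1 derivations when F
   misses it, so the index of F decides which homogeneous alternative can occur. Failure of closedness
   means that F contains all finite subsets of some infinite collection; otherwise the extension order
   on F is well-founded, which bounds all the indices by one countable ordinal. *)

theory Submission
  imports Defs
begin

section \<open>Arithmetic of countable ordinals\<close>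

text \<open>The recursion for the Schreier families branches on the form of the index and uses
  chosen sequences, so arguments about them are hard to run along it; uniformity is the one property
  on which a single induction can run. Both conditions on the ranks matter:
  \<open>r n < \<xi>\<close> makes the induction descend and limits the number of derivations from
  above, while convergence of \<open>r n\<close> to \<xi> limits it from below. The two limits
  differ by one, since at limit ranks no single stage below \<xi> need catch all the ranks
  \<open>r n\<close>. An index of exactly \<xi> + 1 is therefore compatible with both homogeneous
  alternatives, which is why the last case stays undecided. The index can only grow when passing to
  a subcollection, so the homogeneous collection supplied by the Ramsey theorem has to be compared
  with a supremum over all subcollections.\<close>

lemma countable_ordinal_not_less_zero [simp]: "\<not> x < (0 :: countable_ordinal)"
  by (simp add: not_less countable_ordinal_zero_le)

lemma countable_ordinal_gr_zero_iff: "0 < (x :: countable_ordinal) \<longleftrightarrow> x \<noteq> 0"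
  using countable_ordinal_zero_le[of x] by (auto simp: less_le)

lemma bdd_above_countable: "countable (X :: countable_ordinal set) \<Longrightarrow> bdd_above X"
  by (meson bdd_above.I countable_imp_bounded less_imp_le)

lemma osucc_not_zero [simp]: "osucc x \<noteq> 0" "0 \<noteq> osucc x"
  using less_osucc[of x] by (metis countable_ordinal_not_less_zero)+

lemma is_limit_not_osucc: "\<not> is_limit (osucc x)"
  by (auto simp: is_limit_def)

lemma is_limit_not_zero: "\<not> is_limit 0"
  by (auto simp: is_limit_def)

lemma ordinal_cases [case_names zero succ limit]:
  assumes "x = 0 \<Longrightarrow> P" "\<And>y. x = osucc y \<Longrightarrow> P" "is_limit x \<Longrightarrow> P"
  shows P
  using assms unfolding is_limit_def by blast

lemma osucc_less_limit: "is_limit x \<Longrightarrow> y < x \<Longrightarrow> osucc y < x"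
  unfolding is_limit_def by (metis le_less osucc_le_iff)

lemma strict_mono_ge_id:
  fixes f :: "'a::wellorder \<Rightarrow> 'a"
  assumes "\<And>x y. x < y \<Longrightarrow> f x < f y"
  shows "x \<le> f x"
  by (induction x rule: less_induct) (meson assms leD leI)

section \<open>Ordinal addition\<close>

lemma oadd_zero [simp]: "oadd x 0 = x"
  by (simp add: oadd_def transrec_zero)

lemma oadd_osucc [simp]: "oadd x (osucc y) = osucc (oadd x y)"
  by (simp add: oadd_def transrec_osucc)

lemma oadd_limit: "is_limit z \<Longrightarrow> oadd x z = Sup (oadd x ` {..<z})"
  by (simp add: oadd_def transrec_limit)

lemma bdd_above_image_lessThan [simp]:
  fixes f :: "countable_ordinal \<Rightarrow> countable_ordinal"
  shows "bdd_above (f ` {..<z})"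
  by (rule bdd_above_countable[OF countable_image[OF countable_lessThan]])

lemma Sup_upper_image:
  fixes f :: "countable_ordinal \<Rightarrow> countable_ordinal"
  shows "y < z \<Longrightarrow> f y \<le> Sup (f ` {..<z})"
  by (rule cSup_upper) auto

lemma less_Sup_imageD:
  fixes f :: "countable_ordinal \<Rightarrow> countable_ordinal"
  assumes "is_limit z" "x < Sup (f ` {..<z})"
  obtains y where "y < z" "x < f y"
proof -
  have "{..<z} \<noteq> {}" using assms(1) countable_ordinal_zero_le[of z]
    by (auto simp: is_limit_def less_le)
  hence "\<exists>y\<in>f ` {..<z}. x < y"
    using assms(2) by (subst (asm) less_cSup_iff) auto
  thus thesis using that by auto
qed

lemma oadd_strict_mono: "y < z \<Longrightarrow> oadd x y < oadd x z"
proof (induction z rule: less_induct)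
  case (less z)
  show ?case
  proof (cases z rule: ordinal_cases)
    case (succ w)
    hence "y = w \<or> y < w" using less.prems by (auto simp: less_osucc_iff)
    thus ?thesis using less.IH[of w] succ
      by (metis less_osucc less_trans oadd_osucc)
  next
    case limit
    have "oadd x (osucc y) \<le> oadd x z"
      unfolding oadd_limit[OF limit] using osucc_less_limit[OF limit less.prems] by (rule Sup_upper_image)
    thus ?thesis by (simp add: osucc_le_iff)
  qed (use less.prems in auto)
qed

lemma oadd_less_iff [simp]: "oadd x y < oadd x z \<longleftrightarrow> y < z"
  by (metis oadd_strict_mono less_asym linorder_cases)

lemma oadd_le_iff [simp]: "oadd x y \<le> oadd x z \<longleftrightarrow> y \<le> z"
  by (metis oadd_less_iff not_less)

lemma oadd_left_cancel [simp]: "oadd x y = oadd x z \<longleftrightarrow> y = z"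
  by (metis order.eq_iff oadd_le_iff)

lemma le_oadd1: "x \<le> oadd x y"
  using oadd_le_iff[of x 0 y] by (simp add: countable_ordinal_zero_le)

lemma le_oadd2: "y \<le> oadd x y"
  by (rule strict_mono_ge_id) simp

lemma less_oadd_limitD:
  assumes "is_limit z" "w < oadd x z"
  obtains y where "y < z" "w < oadd x y"
  using less_Sup_imageD assms oadd_limit by metis

lemma is_limit_oadd: "is_limit z \<Longrightarrow> is_limit (oadd x z)"
  unfolding is_limit_def[of "oadd x z"]
proof (intro conjI allI notI)
  assume z: "is_limit z"
  show False if "oadd x z = 0"
    using that le_oadd2[of z x] z by (metis countable_ordinal_zero_le is_limit_def order.antisym)
  show False if w: "oadd x z = osucc w" for w
  proof -
    have "w < oadd x z" by (simp add: w less_osucc)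
    then obtain y where "y < z" "w < oadd x y" by (rule less_oadd_limitD[OF z])
    thus False by (metis oadd_less_iff osucc_le_iff w not_less)
  qed
qed

text \<open>Left subtraction: continuity of addition at limits prevents the least \<open>d\<close>
  with \<open>y \<le> oadd x d\<close> from overshooting \<open>y\<close>. It will write ranks above
  \<alpha> as \<open>oadd \<alpha> \<delta>\<close> and split off remainders in Cantor normal
  forms.\<close>

lemma oadd_diff:
  assumes "x \<le> y"
  obtains d where "y = oadd x d"
proof -
  define d where "d = (LEAST d. y \<le> oadd x d)"
  have d: "y \<le> oadd x d" unfolding d_def by (rule LeastI[of _ y]) (rule le_oadd2)
  have least: "oadd x e < y" if "e < d" for e
    using that not_less_Least[of e "\<lambda>d. y \<le> oadd x d"] by (simp add: d_def not_le)
  have "y = oadd x d"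
  proof (cases d rule: ordinal_cases)
    case zero
    thus ?thesis using d assms by simp
  next
    case (succ e)
    thus ?thesis using d least[of e] less_osucc[of e] by (metis oadd_osucc order.antisym osucc_le_iff)
  next
    case limit
    show ?thesis
    proof (rule ccontr)
      assume "y \<noteq> oadd x d"
      hence "y < oadd x d" using d by simp
      then obtain e where "e < d" "y < oadd x e" by (rule less_oadd_limitD[OF limit])
      thus False using least[of e] by simp
    qed
  qed
  thus thesis by (rule that)
qed

lemma oadd_zero_left [simp]: "oadd 0 x = x"
proof -
  obtain d where d: "x = oadd 0 d" by (rule oadd_diff[OF countable_ordinal_zero_le])
  show ?thesis
  proof (rule order.antisym)
    show "oadd 0 x \<le> x"
    proof (induction x rule: less_induct)
      case (less x)
      show ?case
      proof (cases x rule: ordinal_cases)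
        case (succ y)
        thus ?thesis using less[of y] less_osucc[of y]
          by (metis less_osucc_iff oadd_osucc osucc_le_iff)
      next
        case limit
        show ?thesis
        proof (rule ccontr)
          assume "\<not> ?thesis"
          hence "x < oadd 0 x" by simp
          then obtain y where "y < x" "x < oadd 0 y" by (rule less_oadd_limitD[OF limit])
          thus False using less[of y] by simp
        qed
      qed simp
    qed
  qed (rule le_oadd2)
qed

section \<open>Finite multiples and powers of omega\<close>

lemma omult_nat_0 [simp]: "omult_nat x 0 = 0"
  by (simp add: omult_nat_def)

lemma omult_nat_Suc [simp]: "omult_nat x (Suc n) = oadd (omult_nat x n) x"
  by (simp add: omult_nat_def)

lemma omult_nat_strict_mono:
  assumes "0 < x" "m < n"
  shows "omult_nat x m < omult_nat x n"
  using assms(2)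
proof (rule strict_monoD[rotated])
  show "strict_mono (omult_nat x)"
    unfolding strict_mono_Suc_iff
    using assms(1) oadd_less_iff[of _ 0 x] by simp
qed

lemma omega_pow_zero: "omega_pow 0 = osucc 0"
  by (simp add: omega_pow_def transrec_zero)

lemma omega_pow_osucc: "omega_pow (osucc x) = (SUP n. omult_nat (omega_pow x) n)"
  by (simp add: omega_pow_def transrec_osucc)

lemma omega_pow_limit: "is_limit x \<Longrightarrow> omega_pow x = Sup (omega_pow ` {..<x})"
  by (simp add: omega_pow_def transrec_limit)

lemma omult_nat_le_omega_pow: "omult_nat (omega_pow x) n \<le> omega_pow (osucc x)"
  unfolding omega_pow_osucc by (rule cSup_upper) (auto intro: bdd_above_countable)

lemma omega_pow_pos [simp]: "0 < omega_pow x"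
proof (induction x rule: less_induct)
  case (less x)
  show ?case
  proof (cases x rule: ordinal_cases)
    case zero
    thus ?thesis by (simp add: omega_pow_zero less_osucc)
  next
    case (succ y)
    thus ?thesis using less[of y] omult_nat_le_omega_pow[of y 1] less_osucc[of y] by simp
  next
    case limit
    hence "0 < x" by (simp add: is_limit_def countable_ordinal_gr_zero_iff)
    thus ?thesis using Sup_upper_image[of 0 x omega_pow] less[of 0] omega_pow_limit[OF limit]
      by simp
  qed
qed

lemma omult_nat_less_omega_pow: "omult_nat (omega_pow x) n < omega_pow (osucc x)"
  using omult_nat_strict_mono[of "omega_pow x" n "Suc n"] omult_nat_le_omega_pow[of x "Suc n"]
  by (auto simp del: omult_nat_Suc)

lemma less_omega_pow_osuccD:
  assumes "y < omega_pow (osucc x)"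
  obtains n where "y < omult_nat (omega_pow x) n"
  using assms unfolding omega_pow_osucc
  by (subst (asm) less_cSup_iff) (auto intro: bdd_above_countable)

lemma less_omega_pow_limitD:
  assumes "is_limit x" "y < omega_pow x"
  obtains z where "z < x" "y < omega_pow z"
  using less_Sup_imageD assms omega_pow_limit by metis

lemma omega_pow_less_osucc: "omega_pow x < omega_pow (osucc x)"
  using omult_nat_less_omega_pow[of x 1] by simp

lemma omega_pow_strict_mono: "x < y \<Longrightarrow> omega_pow x < omega_pow y"
proof (induction y rule: less_induct)
  case (less y)
  show ?case
  proof (cases y rule: ordinal_cases)
    case (succ w)
    hence "x = w \<or> x < w" using less.prems by (auto simp: less_osucc_iff)
    thus ?thesis using less.IH[of w] succ omega_pow_less_osucc[of w] less_osucc[of w] by auto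
  next
    case limit
    have "omega_pow (osucc x) \<le> omega_pow y"
      unfolding omega_pow_limit[OF limit] using osucc_less_limit[OF limit less.prems]
      by (rule Sup_upper_image)
    thus ?thesis using omega_pow_less_osucc by (rule less_le_trans[rotated])
  qed (use less.prems in auto)
qed

lemma omega_pow_less_iff [simp]: "omega_pow x < omega_pow y \<longleftrightarrow> x < y"
  by (metis omega_pow_strict_mono less_asym linorder_cases)

lemma omega_pow_le_iff [simp]: "omega_pow x \<le> omega_pow y \<longleftrightarrow> x \<le> y"
  by (metis omega_pow_less_iff not_less)

lemma omega_pow_eq_iff [simp]: "omega_pow x = omega_pow y \<longleftrightarrow> x = y"
  by (metis order.eq_iff omega_pow_le_iff)

text \<open>A predecessor \<open>z\<close> of the power would lie below one of the terms whose
  supremum it is; that term would then be at least the whole power, although every term is strictly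
  smaller.\<close>

lemma is_limit_omega_pow:
  assumes "0 < x"
  shows "is_limit (omega_pow x)"
  unfolding is_limit_def
proof (intro conjI allI notI)
  show False if "omega_pow x = 0" using that omega_pow_pos[of x] by simp
  show False if z: "omega_pow x = osucc z" for z
  proof -
    have zx: "z < omega_pow x" by (simp add: z less_osucc)
    show False
    proof (cases x rule: ordinal_cases)
      case (succ y)
      then obtain n where "z < omult_nat (omega_pow y) n" using zx less_omega_pow_osuccD by metis
      hence "omega_pow x \<le> omult_nat (omega_pow y) n" by (simp add: z osucc_le_iff)
      thus False using omult_nat_less_omega_pow[of y n] succ by simp
    next
      case limit
      then obtain y where "y < x" "z < omega_pow y" using zx less_omega_pow_limitD by metis
      thus False by (metis omega_pow_less_iff osucc_le_iff z not_less)
    qed (use assms in auto)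
  qed
qed

lemma is_limit_omult_nat_omega_pow:
  "0 < x \<Longrightarrow> 0 < n \<Longrightarrow> is_limit (omult_nat (omega_pow x) n)"
  by (cases n) (auto simp: is_limit_omega_pow is_limit_oadd)

text \<open>Exponents are positive, so there is no finite part: the lists encode 0 and the limit
  ordinals only, successors having a Schreier rule of their own.\<close>

abbreviation cnf_exponents :: "(countable_ordinal \<times> nat) list \<Rightarrow> bool" where
  "cnf_exponents aps \<equiv> sorted_wrt (>) (map fst aps) \<and> (\<forall>(a, p)\<in>set aps. a > 0 \<and> p \<ge> 1)"

lemma cnf_value_Nil [simp]: "cnf_value [] = 0"
  by (simp add: cnf_value_def)

lemma cnf_value_Cons [simp]:
  "cnf_value ((a, p) # aps) = oadd (omult_nat (omega_pow a) p) (cnf_value aps)"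
  by (simp add: cnf_value_def)

lemma cnf_value_less:
  assumes "cnf_exponents aps" "\<forall>a\<in>fst ` set aps. a < b"
  shows "cnf_value aps < omega_pow b"
  using assms
proof (induction aps arbitrary: b)
  case (Cons ap aps)
  obtain a p where ap: "ap = (a, p)" by fastforce
  have "cnf_value aps < omega_pow a"
    using Cons.prems by (intro Cons.IH) (auto simp: ap)
  hence "cnf_value (ap # aps) < omult_nat (omega_pow a) (Suc p)" by (simp add: ap)
  also have "\<dots> \<le> omega_pow (osucc a)" by (rule omult_nat_le_omega_pow)
  also have "\<dots> \<le> omega_pow b" using Cons.prems by (simp add: ap osucc_le_iff)
  finally show ?case .
qed simp

lemma cnf_value_Cons_bounds:
  assumes "cnf_exponents ((a, p) # aps)"
  shows "omult_nat (omega_pow a) p \<le> cnf_value ((a, p) # aps)"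
    and "cnf_value ((a, p) # aps) < omult_nat (omega_pow a) (Suc p)"
    and "omega_pow a \<le> cnf_value ((a, p) # aps)"
    and "cnf_value ((a, p) # aps) < omega_pow (osucc a)"
proof -
  show *: "omult_nat (omega_pow a) p \<le> cnf_value ((a, p) # aps)" by (simp add: le_oadd1)
  have "cnf_value aps < omega_pow a" using assms by (intro cnf_value_less) auto
  thus **: "cnf_value ((a, p) # aps) < omult_nat (omega_pow a) (Suc p)" by simp
  show "cnf_value ((a, p) # aps) < omega_pow (osucc a)"
    using ** omult_nat_less_omega_pow[of a "Suc p"] by (rule less_trans)
  have "omega_pow a \<le> omult_nat (omega_pow a) p"
    using assms by (cases p) (auto simp: le_oadd2)
  thus "omega_pow a \<le> cnf_value ((a, p) # aps)" using * by (rule order.trans)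
qed

lemma omega_pow_interval_unique:
  assumes "omega_pow a \<le> x" "x < omega_pow (osucc a)" "omega_pow b \<le> x" "x < omega_pow (osucc b)"
  shows "a = b"
  using assms by (metis le_less_trans less_osucc_iff omega_pow_less_iff order.antisym)

text \<open>Consecutive powers of omega fix the leading exponent, consecutive multiples its
  coefficient, and cancellation passes to the tails. Hence the list used in an application of the
  rule \<open>cnf\<close> can be recovered from the index.\<close>

lemma cnf_value_inject:
  assumes "cnf_exponents aps" "cnf_exponents bqs" "cnf_value aps = cnf_value bqs"
  shows "aps = bqs"
  using assms
proof (induction aps arbitrary: bqs)
  case Nil
  show ?case
  proof (cases bqs)
    case (Cons bq bqs')
    obtain b q where bq: "bq = (b, q)" by fastforce
    have "omega_pow b \<le> cnf_value bqs"
      using Nil(2) unfolding Cons bq by (rule cnf_value_Cons_bounds)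
    thus ?thesis using Nil(3) by (metis cnf_value_Nil leD omega_pow_pos)
  qed simp
next
  case (Cons ap aps)
  obtain a p where ap: "ap = (a, p)" by fastforce
  note A = cnf_value_Cons_bounds[OF Cons.prems(1)[unfolded ap]]
  show ?case
  proof (cases bqs)
    case Nil
    thus ?thesis using A(3) Cons.prems(3) ap by (metis cnf_value_Nil leD omega_pow_pos)
  next
    case bqs: (Cons bq bqs')
    obtain b q where bq: "bq = (b, q)" by fastforce
    note B = cnf_value_Cons_bounds[OF Cons.prems(2)[unfolded bqs bq]]
    note eq = Cons.prems(3)[unfolded ap bqs bq]
    have ab: "a = b" using A(3,4) B(3,4) unfolding eq by (rule omega_pow_interval_unique)
    have mono: "Suc n \<le> m \<Longrightarrow> omult_nat (omega_pow a) (Suc n) \<le> omult_nat (omega_pow a) m" for n m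
      using omult_nat_strict_mono[of "omega_pow a" "Suc n" m]
      by (cases "Suc n = m") (auto simp del: omult_nat_Suc)
    have "omult_nat (omega_pow a) q \<le> cnf_value ((a, p) # aps)"
      "cnf_value ((a, p) # aps) < omult_nat (omega_pow a) (Suc q)"
      using B(1,2) eq ab by metis+
    hence "\<not> Suc p \<le> q" "\<not> Suc q \<le> p"
      using mono[of p q] mono[of q p] A(1,2) by (meson leD order.trans)+
    hence pq: "p = q" by simp
    have "cnf_value aps = cnf_value bqs'" using eq by (simp add: ab pq)
    hence "aps = bqs'" using Cons.prems by (intro Cons.IH) (auto simp: bqs)
    thus ?thesis by (simp add: ap bqs bq ab pq)
  qed
qed

lemma is_limit_cnf_value:
  assumes "cnf_exponents aps" "aps \<noteq> []"
  shows "is_limit (cnf_value aps)"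
  using assms
proof (induction aps)
  case (Cons ap aps)
  obtain a p where ap: "ap = (a, p)" by fastforce
  show ?case
    using Cons is_limit_omult_nat_omega_pow[of a p]
    by (cases "aps = []") (auto simp: ap intro!: is_limit_oadd)
qed simp

text \<open>A power already has a one-term normal form with coefficient 1, so uniqueness excludes
  it. This separates the rule \<open>cnf\<close> from the two rules for powers.\<close>

lemma cnf_value_not_omega_pow:
  assumes "cnf_exponents aps" "aps \<noteq> []" "length aps > 1 \<or> snd (hd aps) > 1"
  shows "cnf_value aps \<noteq> omega_pow b"
proof
  assume eq: "cnf_value aps = omega_pow b"
  obtain a p aps' where aps: "aps = (a, p) # aps'" using assms(2) by (cases aps) auto
  note A = cnf_value_Cons_bounds[OF assms(1)[unfolded aps]]
  have "a = b"
    by (rule omega_pow_interval_unique[OF A(3,4)])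
      (use eq aps omega_pow_less_osucc in auto)
  moreover have "b > 0" using assms(1) calculation by (auto simp: aps)
  ultimately have "cnf_value [(b, 1)] = cnf_value aps" "cnf_exponents [(b, 1)]"
    using eq by auto
  hence "[(b, 1)] = aps" using assms(1) by (intro cnf_value_inject)
  thus False using assms(3) by auto
qed

lemma cnf_exists:
  assumes "x = 0 \<or> is_limit x"
  shows "\<exists>aps. cnf_exponents aps \<and> cnf_value aps = x"
  using assms
proof (induction x rule: less_induct)
  case (less x)
  show ?case
  proof (cases "x = 0")
    case True
    thus ?thesis by (intro exI[of _ "[]"]) auto
  next
    case False
    with less.prems have lim: "is_limit x" by simp
    define b where "b = (LEAST b. x < omega_pow b)"
    have "x < omega_pow (osucc x)"
      using strict_mono_ge_id[of omega_pow x] omega_pow_less_osucc[of x]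
      by (auto intro: le_less_trans)
    hence b: "x < omega_pow b" unfolding b_def by (rule LeastI)
    have least: "omega_pow c \<le> x" if "c < b" for c
      using that not_less_Least[of c "\<lambda>b. x < omega_pow b"] by (simp add: b_def not_less)
    \<comment> \<open>By continuity of \<open>omega_pow\<close> the least power above
      \<open>x\<close> cannot have a limit exponent, and exponent 0 would force \<open>x\<close> to
      be 0.\<close>
    obtain a where a: "b = osucc a"
    proof (cases b rule: ordinal_cases)
      case zero
      thus thesis using b False by (auto simp: omega_pow_zero less_osucc_iff order.antisym countable_ordinal_zero_le)
    next
      case limit
      then obtain c where "c < b" "x < omega_pow c" using b by (rule less_omega_pow_limitD)
      thus thesis using least[of c] by simp
    qed
    define n where "n = (LEAST n. x < omult_nat (omega_pow a) n)"
    have n: "x < omult_nat (omega_pow a) n"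
      using less_omega_pow_osuccD[OF b[unfolded a]] unfolding n_def by (metis LeastI)
    then obtain p where p: "n = Suc p" by (cases n) auto
    have "omult_nat (omega_pow a) p \<le> x"
      using not_less_Least[of p "\<lambda>n. x < omult_nat (omega_pow a) n"] p by (simp add: n_def not_less)
    then obtain d where d: "x = oadd (omult_nat (omega_pow a) p) d" by (rule oadd_diff)
    have da: "d < omega_pow a" using n by (simp add: p d)
    have ax: "omega_pow a \<le> x" using least[of a] a less_osucc by simp
    have a0: "a > 0"
    proof (rule ccontr)
      assume "\<not> a > 0"
      hence 0: "a = 0" by (simp add: countable_ordinal_gr_zero_iff)
      hence "d = 0" using da
        by (auto simp: omega_pow_zero less_osucc_iff order.antisym countable_ordinal_zero_le)
      hence "x = omult_nat (osucc 0) p" using d by (simp add: 0 omega_pow_zero)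
      thus False using lim by (cases p) (auto simp: is_limit_not_zero is_limit_not_osucc)
    qed
    have dl: "d = 0 \<or> is_limit d"
      by (cases d rule: ordinal_cases) (use d lim is_limit_not_osucc in auto)
    obtain aps where aps: "cnf_exponents aps" "cnf_value aps = d"
      using less.IH[OF less_le_trans[OF da ax] dl] by blast
    have p1: "p \<ge> 1"
      using ax da d by (cases p) auto
    have "c < a" if c: "c \<in> fst ` set aps" for c
    proof -
      obtain a' p' aps' where aps': "aps = (a', p') # aps'"
        using c by (cases aps) auto
      have "omega_pow a' \<le> d"
        using cnf_value_Cons_bounds(3) aps unfolding aps' by blast
      hence "a' < a" using da by (metis le_less_trans omega_pow_less_iff)
      moreover have "c \<le> a'" using c aps(1) unfolding aps' by force
      ultimately show ?thesis by simp
    qed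
    thus ?thesis using aps a0 p1 d by (intro exI[of _ "(a, p) # aps"]) auto
  qed
qed

section \<open>Uniform families and Schreier families\<close>

lemma set_less_empty [simp]: "{} \<lless> t" "s \<lless> {}"
  by (auto simp: set_less_def)

lemma set_less_Union: "s \<lless> \<Union>T \<longleftrightarrow> (\<forall>t\<in>T. s \<lless> t)"
  by (auto simp: set_less_def)

definition quotient_at :: "nat \<Rightarrow> nat set set \<Rightarrow> nat set set" where
  "quotient_at n A = {s. {n} \<lless> s \<and> insert n s \<in> A}"

definition restrict_above :: "nat \<Rightarrow> nat set set \<Rightarrow> nat set set" where
  "restrict_above n A = {s \<in> A. {n} \<lless> s}"

text \<open>\<open>uniform m \<xi> A\<close> says that, on subsets of \<open>{m<..}\<close>, the family \<open>A\<close> is a \<open>\<xi>\<close>-uniform front in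
  the sense of Pudlak and Roedl. All that is used about Schreier families is this property.\<close>

inductive uniform :: "nat \<Rightarrow> countable_ordinal \<Rightarrow> nat set set \<Rightarrow> bool" where
  zero: "uniform m 0 {{}}"
| step: "\<lbrakk>0 < \<xi>; {} \<notin> A; \<And>n. n > m \<Longrightarrow> r n < \<xi>; \<And>n. n > m \<Longrightarrow> uniform n (r n) (quotient_at n A);
          \<And>\<beta>. \<beta> < \<xi> \<Longrightarrow> \<exists>N. \<forall>n>N. \<beta> \<le> r n\<rbrakk> \<Longrightarrow> uniform m \<xi> A"

lemma empty_notin_uniform: "uniform m \<xi> A \<Longrightarrow> 0 < \<xi> \<Longrightarrow> {} \<notin> A"
  by (auto elim: uniform.cases)

lemma uniform_quotient:
  assumes "uniform m \<xi> A" "0 < \<xi>" "m < n"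
  obtains r where "r < \<xi>" "uniform n r (quotient_at n A)"
  using assms(1)
proof cases
  case (step r)
  thus thesis using that[of "r n"] assms(3) by simp
qed (use assms(2) in simp)

text \<open>A set with least element \<open>n > k\<close> lies above \<open>k\<close> anyway, so the
  quotients at such \<open>n\<close> do not change and the same ranks serve.\<close>

lemma uniform_restrict:
  assumes "uniform m \<xi> A" "m \<le> k"
  shows "uniform k \<xi> (restrict_above k A)"
  using assms(1)
proof cases
  case zero
  have "restrict_above k A = {{}}" by (auto simp: zero restrict_above_def)
  thus ?thesis using zero uniform.zero by simp
next
  case (step r)
  have quot: "quotient_at n (restrict_above k A) = quotient_at n A" if "n > k" for n
  proof -
    have "{k} \<lless> insert n s" if "{n} \<lless> s" for s
      using that \<open>n > k\<close> by (auto simp: set_less_def intro: less_trans)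
    thus ?thesis by (auto simp: quotient_at_def restrict_above_def)
  qed
  show ?thesis
  proof (rule uniform.step[where r = r])
    show "{} \<notin> restrict_above k A" using step(2) by (simp add: restrict_above_def)
    show "r n < \<xi>" "uniform n (r n) (quotient_at n (restrict_above k A))" if "n > k" for n
      using step(3,4)[of n] assms(2) that quot[OF that] by simp_all
  qed (use step in auto)
qed

section \<open>Concatenation of families\<close>

definition concat_family :: "nat set set \<Rightarrow> nat set set \<Rightarrow> nat set set" where
  "concat_family B A = {s \<union> t | s t. s \<in> B \<and> t \<in> A \<and> s \<lless> t}"

lemma concat_family_empty [simp]: "concat_family {{}} A = A" "concat_family A {{}} = A"
  by (auto simp: concat_family_def)

text \<open>Since \<open>B\<close> does not contain the empty set, the least element of a
  concatenation comes from the part in \<open>B\<close>; only that part loses an element, and the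
  part in \<open>A\<close> merely has to stay above \<open>n\<close>.\<close>

lemma quotient_concat_family:
  assumes "{} \<notin> B"
  shows "quotient_at n (concat_family B A) = concat_family (quotient_at n B) (restrict_above n A)"
proof (intro set_eqI iffI)
  fix u assume "u \<in> quotient_at n (concat_family B A)"
  then obtain s t where u: "{n} \<lless> u" "insert n u = s \<union> t" "s \<in> B" "t \<in> A" "s \<lless> t"
    unfolding quotient_at_def concat_family_def by blast
  have nu: "n \<notin> u" using u(1) by (auto simp: set_less_def)
  obtain k where k: "k \<in> s" using u(3) assms by (metis ex_in_conv)
  have "n \<le> k" using k u(1,2) by (metis UnI1 insertE less_imp_le order.refl set_less_def singletonI)
  hence "n \<notin> t" using k u(5) by (meson leD set_less_def)
  hence ns: "n \<in> s" using u(2) by blast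
  hence nt: "{n} \<lless> t" using u(5) by (auto simp: set_less_def)
  have "u = insert n u - {n}" using nu by simp
  also have "\<dots> = (s - {n}) \<union> t" unfolding u(2) using \<open>n \<notin> t\<close> by auto
  finally have "u = (s - {n}) \<union> t" .
  moreover have "s - {n} \<in> quotient_at n B"
    using u ns nu by (auto simp: quotient_at_def set_less_def insert_absorb)
  moreover have "s - {n} \<lless> t" using u(5) by (auto simp: set_less_def)
  ultimately show "u \<in> concat_family (quotient_at n B) (restrict_above n A)"
    using u(4) nt unfolding concat_family_def restrict_above_def by blast
next
  fix u assume "u \<in> concat_family (quotient_at n B) (restrict_above n A)"
  then obtain s t where u: "u = s \<union> t" "{n} \<lless> s" "insert n s \<in> B" "t \<in> A" "{n} \<lless> t" "s \<lless> t"
    unfolding quotient_at_def concat_family_def restrict_above_def by blast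
  have "insert n s \<lless> t" "{n} \<lless> u" using u by (auto simp: set_less_def)
  moreover have "insert n u = insert n s \<union> t" using u(1) by simp
  ultimately show "u \<in> quotient_at n (concat_family B A)"
    using u(3,4) unfolding quotient_at_def concat_family_def by blast
qed

text \<open>The part that comes first contributes the right-hand summand: removing least elements
  consumes \<open>B\<close> and leaves the rank \<alpha> of \<open>A\<close> for the end. For
  convergence, a bound above \<alpha> is written as \<open>oadd \<alpha> \<delta>\<close> with
  \<delta> below the rank of \<open>B\<close>.\<close>

lemma uniform_concat_family:
  assumes "uniform m \<beta> B" "uniform m \<alpha> A"
  shows "uniform m (oadd \<alpha> \<beta>) (concat_family B A)"
  using assms
proof (induction arbitrary: A)
  case (zero m)
  thus ?case by simp
next
  case (step \<xi> B m r)
  show ?case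
  proof (rule uniform.step[where r = "\<lambda>n. oadd \<alpha> (r n)"])
    show "0 < oadd \<alpha> \<xi>" using step.hyps(1) le_oadd2 by (rule less_le_trans)
    show "{} \<notin> concat_family B A" using step.hyps(2) by (auto simp: concat_family_def)
    show "oadd \<alpha> (r n) < oadd \<alpha> \<xi>" if "n > m" for n using step.hyps(3)[OF that] by simp
    show "uniform n (oadd \<alpha> (r n)) (quotient_at n (concat_family B A))" if "n > m" for n
      unfolding quotient_concat_family[OF step.hyps(2)]
      using that step.prems by (intro step.IH uniform_restrict[of m]) auto
    show "\<exists>N. \<forall>n>N. \<beta> \<le> oadd \<alpha> (r n)" if \<beta>: "\<beta> < oadd \<alpha> \<xi>" for \<beta>
    proof (cases "\<beta> \<le> \<alpha>")
      case True
      thus ?thesis using le_oadd1 order.trans by blast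
    next
      case False
      hence "\<alpha> \<le> \<beta>" by simp
      then obtain \<delta> where \<delta>: "\<beta> = oadd \<alpha> \<delta>" by (rule oadd_diff)
      thus ?thesis using step.hyps(5)[of \<delta>] \<beta> by simp
    qed
  qed
qed

definition power_family :: "nat \<Rightarrow> nat set set \<Rightarrow> nat set set" where
  "power_family p A = {\<Union>(set ss) | ss. length ss = p \<and> sorted_wrt (\<lless>) ss \<and> set ss \<subseteq> A}"

lemma power_family_0 [simp]: "power_family 0 A = {{}}"
  by (auto simp: power_family_def)

lemma power_family_Suc [simp]: "power_family (Suc p) A = concat_family A (power_family p A)"
proof (intro set_eqI iffI)
  fix u assume "u \<in> power_family (Suc p) A"
  then obtain ss where ss: "u = \<Union>(set ss)" "length ss = Suc p" "sorted_wrt (\<lless>) ss" "set ss \<subseteq> A"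
    unfolding power_family_def by blast
  then obtain s ss' where "ss = s # ss'" by (cases ss) auto
  with ss show "u \<in> concat_family A (power_family p A)"
    unfolding concat_family_def power_family_def mem_Collect_eq
    by (intro exI[of _ s] exI[of _ "\<Union>(set ss')"] conjI exI[of _ ss']) (auto simp: set_less_Union)
next
  fix u assume "u \<in> concat_family A (power_family p A)"
  then obtain s ss where "u = s \<union> \<Union>(set ss)" "s \<in> A" "length ss = p" "sorted_wrt (\<lless>) ss"
    "set ss \<subseteq> A" "s \<lless> \<Union>(set ss)"
    unfolding concat_family_def power_family_def by blast
  thus "u \<in> power_family (Suc p) A"
    unfolding power_family_def by (auto simp: set_less_Union intro!: exI[of _ "s # ss"])
qed

lemma uniform_power_family:
  "uniform m \<alpha> A \<Longrightarrow> uniform m (omult_nat \<alpha> p) (power_family p A)"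
  by (induction p) (simp_all add: uniform.zero uniform_concat_family)

text \<open>The head of the list comes last in the set: the part with the largest exponent is the
  rightmost one and so yields the left-hand summand of the normal form.\<close>

fun cnf_family :: "('a \<Rightarrow> nat set set) \<Rightarrow> ('a \<times> nat) list \<Rightarrow> nat set set" where
  "cnf_family f [] = {{}}"
| "cnf_family f ((a, p) # aps) = concat_family (cnf_family f aps) (power_family p (f a))"

lemma uniform_cnf_family:
  assumes "\<And>a p. (a, p) \<in> set aps \<Longrightarrow> uniform m (omega_pow a) (f a)"
  shows "uniform m (cnf_value aps) (cnf_family f aps)"
  using assms
proof (induction aps)
  case (Cons ap aps)
  thus ?case by (cases ap) (auto intro!: uniform_concat_family uniform_power_family)
qed (simp add: uniform.zero)

lemma set_less_Union_left: "\<Union>S \<lless> t \<longleftrightarrow> (\<forall>s\<in>S. s \<lless> t)"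
  by (auto simp: set_less_def)

text \<open>Brings the iterated concatenation into the format of the premises of the rule
  \<open>cnf\<close>, with one list of successive sets for each term of the normal form.\<close>

lemma mem_cnf_family_iff:
  "u \<in> cnf_family f aps \<longleftrightarrow>
     (\<exists>tss. length tss = length aps \<and>
        (\<forall>i<length aps. length (tss ! i) = snd (aps ! i) \<and> sorted_wrt (\<lless>) (tss ! i) \<and>
           (\<forall>t\<in>set (tss ! i). t \<in> f (fst (aps ! i)))) \<and>
        sorted_wrt (\<lambda>s s'. s' \<lless> s) (map (\<lambda>ts. \<Union>(set ts)) tss) \<and>
        u = (\<Union>ts\<in>set tss. \<Union>(set ts)))"
proof (induction aps arbitrary: u)
  case (Cons ap aps)
  obtain a p where ap: "ap = (a, p)" by fastforce
  show ?case (is "?L \<longleftrightarrow> ?R")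
  proof
    assume ?L
    then obtain s t where u: "u = s \<union> t" "s \<in> cnf_family f aps" "t \<in> power_family p (f a)" "s \<lless> t"
      unfolding ap cnf_family.simps concat_family_def by blast
    obtain ts where ts: "t = \<Union>(set ts)" "length ts = p" "sorted_wrt (\<lless>) ts" "set ts \<subseteq> f a"
      using u(3) unfolding power_family_def by blast
    obtain tss where "length tss = length aps"
      "\<forall>i<length aps. length (tss ! i) = snd (aps ! i) \<and> sorted_wrt (\<lless>) (tss ! i) \<and>
           (\<forall>t\<in>set (tss ! i). t \<in> f (fst (aps ! i)))"
      "sorted_wrt (\<lambda>s s'. s' \<lless> s) (map (\<lambda>ts. \<Union>(set ts)) tss)"
      "s = (\<Union>ts\<in>set tss. \<Union>(set ts))"
      using u(2) unfolding Cons.IH by blast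
    thus ?R using u ts
      by (intro exI[of _ "ts # tss"]) (auto simp: ap nth_Cons' less_Suc_eq_0_disj set_less_Union_left)
  next
    assume ?R
    then obtain tss where tss: "length tss = length (ap # aps)"
      "\<And>i. i < length (ap # aps) \<Longrightarrow> length (tss ! i) = snd ((ap # aps) ! i) \<and>
         sorted_wrt (\<lless>) (tss ! i) \<and> (\<forall>t\<in>set (tss ! i). t \<in> f (fst ((ap # aps) ! i)))"
      "sorted_wrt (\<lambda>s s'. s' \<lless> s) (map (\<lambda>ts. \<Union>(set ts)) tss)"
      "u = (\<Union>ts\<in>set tss. \<Union>(set ts))"
      by blast
    then obtain ts tss' where Cons': "tss = ts # tss'" by (cases tss) auto
    have "(\<Union>ts\<in>set tss'. \<Union>(set ts)) \<in> cnf_family f aps"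
      unfolding Cons.IH
      using tss(1,3) tss(2)[of "Suc _"] by (intro exI[of _ tss']) (auto simp: Cons')
    moreover have "\<Union>(set ts) \<in> power_family p (f a)"
      using tss(2)[of 0] unfolding power_family_def by (auto simp: Cons' ap)
    moreover have "(\<Union>ts\<in>set tss'. \<Union>(set ts)) \<lless> \<Union>(set ts)"
      using tss(3) by (fastforce simp: Cons' set_less_def)
    moreover have "u = (\<Union>ts\<in>set tss'. \<Union>(set ts)) \<union> \<Union>(set ts)" using tss(4) by (auto simp: Cons')
    ultimately show ?L
      unfolding ap cnf_family.simps concat_family_def by blast
  qed
qed simp

abbreviation schreier_family ::
  "(countable_ordinal \<Rightarrow> nat \<Rightarrow> countable_ordinal) \<Rightarrow> countable_ordinal \<Rightarrow> nat set set" where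
  "schreier_family L \<xi> \<equiv> Collect (schreier L \<xi>)"

section \<open>Inversion of the Schreier rules\<close>

lemma schreier_finite: "schreier L \<xi> s \<Longrightarrow> finite s"
proof (induction rule: schreier.induct)
  case (cnf aps tss)
  show ?case
  proof (intro finite_Union finite_imageI finite_set ballI)
    fix T assume "T \<in> (\<lambda>ts. \<Union>(set ts)) ` set tss"
    then obtain i where "i < length aps" "T = \<Union>(set (tss ! i))"
      using cnf(5) by (auto simp: in_set_conv_nth)
    thus "finite T" using cnf.IH cnf.hyps by auto
  qed
qed auto

lemma omega_pow_osucc_limit: "is_limit (omega_pow (osucc x))"
  by (rule is_limit_omega_pow) (simp add: countable_ordinal_gr_zero_iff)

lemma omega_pow_limit_limit: "is_limit x \<Longrightarrow> is_limit (omega_pow x)"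
  by (rule is_limit_omega_pow) (simp add: countable_ordinal_gr_zero_iff is_limit_def)

text \<open>Here and in the next inversions the five rules are told apart by their indices: zero,
  successors, powers of omega with successor or limit exponent, and limit ordinals that are not
  powers.\<close>

lemma schreier_zero_iff: "schreier L 0 s \<longleftrightarrow> s = {}"
proof
  assume "schreier L 0 s"
  thus "s = {}"
  proof cases
    case (omega_succ ss \<beta>)
    thus ?thesis using omega_pow_osucc_limit[of \<beta>] is_limit_not_zero by simp
  next
    case (omega_limit x)
    thus ?thesis using omega_pow_limit_limit[of x] is_limit_not_zero by simp
  next
    case (cnf aps tss)
    thus ?thesis using is_limit_cnf_value[of aps] is_limit_not_zero by simp
  qed auto
qed (auto intro: schreier.zero)

lemma schreier_osucc_iff:
  "schreier L (osucc \<zeta>) s \<longleftrightarrow> (\<exists>n t. n \<ge> 1 \<and> {n} \<lless> t \<and> schreier L \<zeta> t \<and> s = insert n t)"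
proof
  assume "schreier L (osucc \<zeta>) s"
  thus "\<exists>n t. n \<ge> 1 \<and> {n} \<lless> t \<and> schreier L \<zeta> t \<and> s = insert n t"
  proof cases
    case (omega_succ ss \<beta>)
    thus ?thesis using omega_pow_osucc_limit[of \<beta>] is_limit_not_osucc[of \<zeta>] by simp
  next
    case (omega_limit x)
    thus ?thesis using omega_pow_limit_limit[of x] is_limit_not_osucc[of \<zeta>] by simp
  next
    case (cnf aps tss)
    thus ?thesis using is_limit_cnf_value[of aps] is_limit_not_osucc[of \<zeta>] by simp
  qed (auto simp: osucc_inject)
qed (auto intro: schreier.succ)

lemma schreier_omega_osucc_iff:
  "schreier L (omega_pow (osucc \<beta>)) s \<longleftrightarrow>
     (\<exists>ss. ss \<noteq> [] \<and> set ss \<subseteq> schreier_family L (omega_pow \<beta>) \<and> sorted_wrt (\<lless>) ss \<and>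
        length ss = Min (hd ss) \<and> s = \<Union>(set ss))"
proof
  note lim = omega_pow_osucc_limit[of \<beta>]
  assume "schreier L (omega_pow (osucc \<beta>)) s"
  thus "\<exists>ss. ss \<noteq> [] \<and> set ss \<subseteq> schreier_family L (omega_pow \<beta>) \<and> sorted_wrt (\<lless>) ss \<and>
        length ss = Min (hd ss) \<and> s = \<Union>(set ss)"
  proof cases
    case zero
    thus ?thesis using lim is_limit_not_zero by simp
  next
    case (succ \<zeta> s n)
    thus ?thesis using lim is_limit_not_osucc[of \<zeta>] by simp
  next
    case (omega_succ ss \<beta>')
    thus ?thesis by (intro exI[of _ ss]) (auto simp: osucc_inject)
  next
    case (omega_limit x)
    thus ?thesis using is_limit_not_osucc[of \<beta>] by simp
  next
    case (cnf aps tss)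
    thus ?thesis using cnf_value_not_omega_pow[of aps "osucc \<beta>"] by simp
  qed
qed (auto intro!: schreier.omega_succ)

lemma schreier_omega_limit_iff:
  assumes "is_limit x"
  shows "schreier L (omega_pow x) s \<longleftrightarrow> s \<noteq> {} \<and> schreier L (omega_pow (L x (Min s))) s"
proof
  note lim = omega_pow_limit_limit[OF assms]
  assume "schreier L (omega_pow x) s"
  thus "s \<noteq> {} \<and> schreier L (omega_pow (L x (Min s))) s"
  proof cases
    case zero
    thus ?thesis using lim is_limit_not_zero by simp
  next
    case (succ \<zeta> s n)
    thus ?thesis using lim is_limit_not_osucc[of \<zeta>] by simp
  next
    case (omega_succ ss \<beta>)
    thus ?thesis using assms is_limit_not_osucc[of \<beta>] by simp
  next
    case (cnf aps tss)
    thus ?thesis using cnf_value_not_omega_pow[of aps x] by simp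
  qed auto
qed (use assms in \<open>auto intro: schreier.omega_limit\<close>)

lemma schreier_family_cnf_value:
  assumes "cnf_exponents aps" "aps \<noteq> []" "length aps > 1 \<or> snd (hd aps) > 1"
  shows "schreier_family L (cnf_value aps) = cnf_family (\<lambda>a. schreier_family L (omega_pow a)) aps"
proof (intro set_eqI iffI)
  note lim = is_limit_cnf_value[OF assms(1,2)] and not_pow = cnf_value_not_omega_pow[OF assms]
  fix s assume "s \<in> schreier_family L (cnf_value aps)"
  hence "schreier L (cnf_value aps) s" by simp
  thus "s \<in> cnf_family (\<lambda>a. schreier_family L (omega_pow a)) aps"
  proof cases
    case zero
    thus ?thesis using lim is_limit_not_zero by simp
  next
    case (succ \<zeta> s n)
    thus ?thesis using lim is_limit_not_osucc[of \<zeta>] by simp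
  next
    case (omega_succ ss \<beta>)
    thus ?thesis using not_pow by simp
  next
    case (omega_limit x)
    thus ?thesis using not_pow by simp
  next
    case (cnf bqs tss)
    have "aps = bqs" using assms(1) cnf by (intro cnf_value_inject) auto
    thus ?thesis unfolding mem_cnf_family_iff using cnf by (intro exI[of _ tss]) auto
  qed
next
  fix s assume "s \<in> cnf_family (\<lambda>a. schreier_family L (omega_pow a)) aps"
  then obtain tss where "length tss = length aps"
    "\<forall>i<length aps. length (tss ! i) = snd (aps ! i) \<and> sorted_wrt (\<lless>) (tss ! i) \<and>
       (\<forall>t\<in>set (tss ! i). schreier L (omega_pow (fst (aps ! i))) t)"
    "sorted_wrt (\<lambda>s s'. s' \<lless> s) (map (\<lambda>ts. \<Union>(set ts)) tss)"
    "s = (\<Union>ts\<in>set tss. \<Union>(set ts))"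
    unfolding mem_cnf_family_iff by blast
  thus "s \<in> schreier_family L (cnf_value aps)"
    using assms by (auto intro!: schreier.cnf simp del: UN_iff)
qed

section \<open>Uniformity of the Schreier families\<close>

lemma Min_insert_set_less: "finite s \<Longrightarrow> {n} \<lless> s \<Longrightarrow> Min (insert n s) = n"
  by (rule Min_eqI) (auto simp: set_less_def less_imp_le)

text \<open>The least element of a member prescribes the number of its summands; once it is fixed as
  \<open>n\<close>, the family looks like an \<open>n\<close>-fold power. As no summand is empty,
  the least element of the union is that of the first summand.\<close>

lemma quotient_schreier_omega_osucc:
  assumes "{} \<notin> schreier_family L (omega_pow \<beta>)" "n \<ge> 1"
  shows "quotient_at n (schreier_family L (omega_pow (osucc \<beta>))) =
    quotient_at n (power_family n (schreier_family L (omega_pow \<beta>)))"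
proof -
  have Min: "n = Min s"
    if u: "insert n u = \<Union>(set (s # ss))" "{n} \<lless> u" and ss: "sorted_wrt (\<lless>) (s # ss)"
      and s: "schreier L (omega_pow \<beta>) s" for s ss u
  proof (rule Min_eqI[symmetric])
    show "finite s" using s by (rule schreier_finite)
    show le: "n \<le> k" if "k \<in> s" for k
    proof -
      have "k \<in> insert n u" using that unfolding u(1) by simp
      thus ?thesis using u(2) by (auto simp: set_less_def)
    qed
    obtain k where k: "k \<in> s" using s assms(1) by (metis ex_in_conv mem_Collect_eq)
    have "n \<notin> t" if "t \<in> set ss" for t
      using ss that k le[OF k] by (metis leD set_less_def sorted_wrt.simps(2))
    moreover have "n \<in> \<Union>(set (s # ss))" unfolding u(1)[symmetric] by simp
    ultimately show "n \<in> s" by auto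
  qed
  show ?thesis
  proof (intro set_eqI iffI)
    fix u assume "u \<in> quotient_at n (schreier_family L (omega_pow (osucc \<beta>)))"
    then obtain ss where u: "{n} \<lless> u" "insert n u = \<Union>(set ss)" and
      ss: "ss \<noteq> []" "set ss \<subseteq> schreier_family L (omega_pow \<beta>)" "sorted_wrt (\<lless>) ss" "length ss = Min (hd ss)"
      unfolding quotient_at_def schreier_omega_osucc_iff mem_Collect_eq by blast
    obtain s ss' where "ss = s # ss'" using ss(1) by (cases ss) auto
    hence "length ss = n" using Min[of u s ss'] u ss by auto
    thus "u \<in> quotient_at n (power_family n (schreier_family L (omega_pow \<beta>)))"
      unfolding quotient_at_def power_family_def using u ss by blast
  next
    fix u assume "u \<in> quotient_at n (power_family n (schreier_family L (omega_pow \<beta>)))"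
    then obtain ss where u: "{n} \<lless> u" "insert n u = \<Union>(set ss)" and
      ss: "length ss = n" "set ss \<subseteq> schreier_family L (omega_pow \<beta>)" "sorted_wrt (\<lless>) ss"
      unfolding quotient_at_def power_family_def by blast
    obtain s ss' where "ss = s # ss'" using ss(1) assms(2) by (cases ss) auto
    hence "length ss = Min (hd ss)" "ss \<noteq> []" using Min[of u s ss'] u ss by auto
    thus "u \<in> quotient_at n (schreier_family L (omega_pow (osucc \<beta>)))"
      unfolding quotient_at_def schreier_omega_osucc_iff mem_Collect_eq using u ss by blast
  qed
qed

text \<open>The quotient touches only the first of \<open>n\<close> factors, whose rank drops below
  \<open>omega_pow \<beta>\<close>; the other \<open>n - 1\<close> factors contribute the left-hand
  summand. Both bounds are recorded because limit exponents need them with a \<beta> that varies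
  with \<open>n\<close>.\<close>

lemma uniform_quotient_schreier_omega_osucc:
  assumes "uniform 0 (omega_pow \<beta>) (schreier_family L (omega_pow \<beta>))" "n \<ge> 1"
  obtains r where "omult_nat (omega_pow \<beta>) (n - 1) \<le> r" "r < omult_nat (omega_pow \<beta>) n"
    "uniform n r (quotient_at n (schreier_family L (omega_pow (osucc \<beta>))))"
proof -
  let ?A = "schreier_family L (omega_pow \<beta>)"
  have empty: "{} \<notin> ?A" using empty_notin_uniform[OF assms(1)] by simp
  obtain k where n: "n = Suc k" using assms(2) by (cases n) auto
  obtain r where r: "r < omega_pow \<beta>" "uniform n r (quotient_at n ?A)"
    by (rule uniform_quotient[OF assms(1), of n]) (use assms(2) in auto)
  have "uniform n (omult_nat (omega_pow \<beta>) k) (restrict_above n (power_family k ?A))"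
    using uniform_restrict[OF uniform_power_family[OF assms(1)]] by simp
  from uniform_concat_family[OF r(2) this]
  have "uniform n (oadd (omult_nat (omega_pow \<beta>) k) r)
      (quotient_at n (schreier_family L (omega_pow (osucc \<beta>))))"
    unfolding quotient_schreier_omega_osucc[OF empty assms(2)] unfolding n power_family_Suc
    by (subst quotient_concat_family) (use empty in auto)
  thus thesis using r(1) by (intro that) (auto simp: n le_oadd1)
qed

lemma uniform_schreier_omega_osucc:
  assumes A: "uniform 0 (omega_pow \<beta>) (schreier_family L (omega_pow \<beta>))"
  shows "uniform 0 (omega_pow (osucc \<beta>)) (schreier_family L (omega_pow (osucc \<beta>)))"
proof -
  let ?A = "schreier_family L (omega_pow (osucc \<beta>))"
  have "\<exists>r. n \<ge> 1 \<longrightarrow> omult_nat (omega_pow \<beta>) (n - 1) \<le> r \<and> r < omult_nat (omega_pow \<beta>) n \<and>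
     uniform n r (quotient_at n ?A)" for n
    using uniform_quotient_schreier_omega_osucc[OF A] by metis
  then obtain r where r: "n \<ge> 1 \<longrightarrow> omult_nat (omega_pow \<beta>) (n - 1) \<le> r n \<and>
     r n < omult_nat (omega_pow \<beta>) n \<and> uniform n (r n) (quotient_at n ?A)" for n
    by metis
  show ?thesis
  proof (rule uniform.step[where r = r])
    show "{} \<notin> ?A"
      using empty_notin_uniform[OF A] by (auto simp: schreier_omega_osucc_iff neq_Nil_conv)
    show "r n < omega_pow (osucc \<beta>)" if "n > 0" for n
      using r[of n] that omult_nat_le_omega_pow[of \<beta> n] by (auto intro: less_le_trans)
    show "\<exists>N. \<forall>n>N. \<gamma> \<le> r n" if \<gamma>: "\<gamma> < omega_pow (osucc \<beta>)" for \<gamma>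
    proof -
      obtain N where N: "\<gamma> < omult_nat (omega_pow \<beta>) N" using \<gamma> by (rule less_omega_pow_osuccD)
      \<comment> \<open>The rank at \<open>n\<close> is only known to be at least the multiple with
        factor \<open>n - 1\<close>, hence the shift by one.\<close>
      have "\<gamma> \<le> r n" if "n > Suc N" for n
      proof -
        have "omult_nat (omega_pow \<beta>) N < omult_nat (omega_pow \<beta>) (n - 1)"
          using that by (intro omult_nat_strict_mono) auto
        thus ?thesis using N r[of n] that by auto
      qed
      thus ?thesis by blast
    qed
  qed (use r in auto)
qed

text \<open>Because \<open>L x n\<close> is a successor \<open>osucc (b n)\<close>, the quotient at
  \<open>n\<close> is one already analysed. The ladder is cofinal, so the exponents
  \<open>b n\<close> eventually reach every \<delta> below \<open>x\<close> and drive the ranks up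
  to \<open>omega_pow x\<close>.\<close>

lemma uniform_schreier_omega_limit:
  assumes L: "ladder_system L" and x: "is_limit x"
    and A: "\<And>\<beta>. \<beta> < x \<Longrightarrow> uniform 0 (omega_pow \<beta>) (schreier_family L (omega_pow \<beta>))"
  shows "uniform 0 (omega_pow x) (schreier_family L (omega_pow x))"
proof -
  let ?A = "schreier_family L (omega_pow x)"
  have mono: "strict_mono_on {1..} (L x)" and less: "\<And>n. n \<ge> 1 \<Longrightarrow> L x n < x"
    and succ: "\<And>n. n \<ge> 1 \<Longrightarrow> \<exists>y. L x n = osucc y" and Sup: "(SUP n\<in>{1..}. L x n) = x"
    using L x unfolding ladder_system_def by blast+
  have quot: "quotient_at n ?A = quotient_at n (schreier_family L (omega_pow (L x n)))" for n
  proof -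
    have "schreier L (omega_pow x) (insert n s) \<longleftrightarrow> schreier L (omega_pow (L x n)) (insert n s)"
      if "{n} \<lless> s" for s
    proof (cases "finite s")
      case True
      thus ?thesis using Min_insert_set_less[OF True that] by (simp add: schreier_omega_limit_iff[OF x])
    next
      case False
      thus ?thesis using schreier_finite[of L _ "insert n s"] by auto
    qed
    thus ?thesis unfolding quotient_at_def by blast
  qed
  have "\<exists>r \<beta>. n \<ge> 1 \<longrightarrow> L x n = osucc \<beta> \<and> omult_nat (omega_pow \<beta>) (n - 1) \<le> r \<and>
     r < omult_nat (omega_pow \<beta>) n \<and> uniform n r (quotient_at n ?A)" for n
  proof (cases "n \<ge> 1")
    case True
    obtain \<beta> where \<beta>: "L x n = osucc \<beta>" using succ[OF True] by blast
    hence "\<beta> < x" using less[OF True] less_osucc[of \<beta>] by simp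
    from uniform_quotient_schreier_omega_osucc[OF A[OF this] True]
    show ?thesis unfolding quot \<beta> by metis
  qed auto
  then obtain r b where r: "n \<ge> 1 \<longrightarrow> L x n = osucc (b n) \<and> omult_nat (omega_pow (b n)) (n - 1) \<le> r n \<and>
     r n < omult_nat (omega_pow (b n)) n \<and> uniform n (r n) (quotient_at n ?A)" for n
    by metis
  show ?thesis
  proof (rule uniform.step[where r = r])
    show "{} \<notin> ?A" by (simp add: schreier_omega_limit_iff[OF x])
    show "r n < omega_pow x" if "n > 0" for n
    proof -
      have "r n < omult_nat (omega_pow (b n)) n" using r[of n] that by simp
      also have "\<dots> \<le> omega_pow (L x n)" using r[of n] that omult_nat_le_omega_pow by simp
      also have "\<dots> < omega_pow x" using less[of n] that by simp
      finally show ?thesis .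
    qed
    show "\<exists>N. \<forall>n>N. \<gamma> \<le> r n" if \<gamma>: "\<gamma> < omega_pow x" for \<gamma>
    proof -
      obtain \<delta> where \<delta>: "\<delta> < x" "\<gamma> < omega_pow \<delta>" using \<gamma> by (rule less_omega_pow_limitD[OF x])
      have "\<delta> < Sup (L x ` {1..})" unfolding Sup by (rule \<delta>(1))
      hence "\<exists>y\<in>L x ` {1..}. \<delta> < y"
        by (subst (asm) less_cSup_iff) (auto intro: bdd_above_countable)
      then obtain N where N: "N \<ge> 1" "\<delta> < L x N" by auto
      have "\<gamma> \<le> r n" if "n > N" for n
      proof -
        have "L x N < L x n" using mono N(1) that by (auto simp: strict_mono_on_def)
        hence "\<delta> \<le> b n" using N r[of n] that by (simp add: less_osucc_iff)
        hence "omega_pow \<delta> \<le> omega_pow (b n)" by simp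
        \<comment> \<open>From \<open>n > N \<ge> 1\<close> the factor \<open>n - 1\<close> is
          positive, so the multiple contains the power at least once.\<close>
        also have "\<dots> \<le> omult_nat (omega_pow (b n)) (n - 1)"
          using N(1) that by (cases "n - 1") (auto simp: le_oadd2)
        also have "\<dots> \<le> r n" using r[of n] N(1) that by simp
        finally show ?thesis using \<delta>(2) by simp
      qed
      thus ?thesis by blast
    qed
  qed (use r in auto)
qed

theorem uniform_schreier:
  assumes L: "ladder_system L"
  shows "uniform 0 \<xi> (schreier_family L \<xi>)"
proof (induction \<xi> rule: less_induct)
  case (less \<xi>)
  show ?case
  proof (cases \<xi> rule: ordinal_cases)
    case zero
    have "schreier_family L 0 = {{}}" by (auto simp: schreier_zero_iff)
    thus ?thesis using uniform.zero zero by simp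
  next
    case (succ \<zeta>)
    \<comment> \<open>The element put in front by the successor rule is the least one, so every
      quotient is the preceding family beyond \<open>n\<close>, of constant rank \<zeta>.\<close>
    have "quotient_at n (schreier_family L \<xi>) = restrict_above n (schreier_family L \<zeta>)"
      if "n \<ge> 1" for n
    proof (intro set_eqI iffI)
      fix s assume "s \<in> quotient_at n (schreier_family L \<xi>)"
      then obtain k t where s: "{n} \<lless> s" "{k} \<lless> t" "schreier L \<zeta> t" "insert n s = insert k t"
        unfolding quotient_at_def succ schreier_osucc_iff mem_Collect_eq by blast
      have "n = k"
      proof (rule ccontr)
        assume "n \<noteq> k"
        hence "n \<in> t" "k \<in> s" using s(4) by (metis insertE insertI1)+
        thus False using s(1,2) by (metis less_asym set_less_def singletonI)
      qed
      moreover have "n \<notin> s" "k \<notin> t" using s(1,2) by (auto simp: set_less_def)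
      ultimately have "s = t" using s(4) insert_ident[of n s t] by simp
      thus "s \<in> restrict_above n (schreier_family L \<zeta>)" using s by (simp add: restrict_above_def)
    next
      fix s assume "s \<in> restrict_above n (schreier_family L \<zeta>)"
      thus "s \<in> quotient_at n (schreier_family L \<xi>)"
        using that by (auto simp: restrict_above_def quotient_at_def succ intro!: schreier.succ)
    qed
    moreover have "uniform n \<zeta> (restrict_above n (schreier_family L \<zeta>))" for n
      using less.IH[of \<zeta>] by (intro uniform_restrict) (auto simp: succ less_osucc)
    moreover have "{} \<notin> schreier_family L \<xi>" by (auto simp: succ schreier_osucc_iff)
    moreover have "0 < \<xi>" by (simp add: succ countable_ordinal_gr_zero_iff)
    ultimately show ?thesis
      by - (rule uniform.step[where r = "\<lambda>_. \<zeta>"], simp_all add: succ less_osucc less_osucc_iff)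
  next
    case limit
    then obtain aps where aps: "cnf_exponents aps" "cnf_value aps = \<xi>" using cnf_exists by blast
    hence ne: "aps \<noteq> []" using limit by (auto simp: is_limit_not_zero)
    then obtain a p aps' where Cons: "aps = (a, p) # aps'" by (cases aps) auto
    show ?thesis
    proof (cases "length aps > 1 \<or> snd (hd aps) > 1")
      case True
      \<comment> \<open>As \<xi> is not itself a power, all powers in its normal form are strictly
        smaller and fall under the induction hypothesis.\<close>
      have "omega_pow b < \<xi>" if "(b, q) \<in> set aps" for b q
      proof -
        have "b \<le> a" using that aps(1) by (force simp: Cons)
        hence "omega_pow b \<le> omega_pow a" by simp
        also have "\<dots> \<le> \<xi>" using cnf_value_Cons_bounds(3) aps unfolding Cons by blast
        finally have "omega_pow b \<le> \<xi>" .
        thus ?thesis using cnf_value_not_omega_pow[OF aps(1) ne True, of b] aps(2) by simp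
      qed
      hence "uniform 0 (cnf_value aps) (cnf_family (\<lambda>a. schreier_family L (omega_pow a)) aps)"
        by (intro uniform_cnf_family less.IH) auto
      thus ?thesis using schreier_family_cnf_value[OF aps(1) ne True, of L] aps(2) by simp
    next
      case False
      hence "aps' = []" "p = 1" "a > 0" using aps(1) by (auto simp: Cons)
      hence \<xi>: "\<xi> = omega_pow a" using aps(2) by (simp add: Cons)
      show ?thesis
      proof (cases a rule: ordinal_cases)
        case zero
        thus ?thesis using \<open>a > 0\<close> by simp
      next
        case (succ \<beta>)
        show ?thesis using less.IH[of "omega_pow \<beta>"] omega_pow_less_osucc[of \<beta>]
          unfolding \<xi> succ by (intro uniform_schreier_omega_osucc) auto
      next
        case lim: limit
        show ?thesis unfolding \<xi>
        proof (rule uniform_schreier_omega_limit[OF L lim])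
          show "uniform 0 (omega_pow \<beta>) (schreier_family L (omega_pow \<beta>))" if "\<beta> < a" for \<beta>
            using that by (intro less.IH) (simp add: \<xi>)
        qed
      qed
    qed
  qed
qed

section \<open>Hindman's theorem and the block Ramsey theorem\<close>

text \<open>Without the enumeration, finite and infinite disjoint collections differ only in
  cardinality and passing to subsets is immediate; the order can be recovered from the
  minima.\<close>

definition collection :: "nat set set \<Rightarrow> bool" where
  "collection C \<longleftrightarrow> C \<subseteq> finsets - {{}} \<and> (\<forall>s\<in>C. \<forall>t\<in>C. s \<noteq> t \<longrightarrow> s \<lless> t \<or> t \<lless> s)"

lemma finsetsD: "s \<in> finsets - {{}} \<Longrightarrow> finite s \<and> s \<noteq> {}"
  by (auto simp: finsets_def)

lemma set_less_trans: "s \<lless> t \<Longrightarrow> t \<lless> u \<Longrightarrow> t \<noteq> {} \<Longrightarrow> s \<lless> u"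
  unfolding set_less_def by (metis ex_in_conv less_trans)

lemma set_less_imp_Min_less:
  assumes "s \<lless> t" "s \<in> finsets - {{}}" "t \<in> finsets - {{}}"
  shows "Min s < Min t"
  using assms finsetsD Min_in unfolding set_less_def by meson

lemma set_less_irrefl: "s \<noteq> {} \<Longrightarrow> \<not> s \<lless> s"
  by (auto simp: set_less_def)

lemma set_less_asym: "s \<lless> t \<Longrightarrow> t \<lless> s \<Longrightarrow> s = {} \<or> t = {}"
  unfolding set_less_def by (meson ex_in_conv less_asym)

lemma collection_subset: "collection C \<Longrightarrow> B \<subseteq> C \<Longrightarrow> collection B"
  unfolding collection_def by (meson subsetD subset_trans)

lemma collection_insert_first:
  assumes "collection C" "t \<in> finsets - {{}}" "\<And>x. x \<in> C \<Longrightarrow> t \<lless> x"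
  shows "collection (insert t C)"
  using assms unfolding collection_def by auto

lemma collection_insert_last:
  assumes "collection C" "t \<in> finsets - {{}}" "\<And>x. x \<in> C \<Longrightarrow> x \<lless> t"
  shows "collection (insert t C)"
  using assms unfolding collection_def by auto

lemma collection_Min_inj: "collection C \<Longrightarrow> inj_on Min C"
  unfolding inj_on_def collection_def using set_less_imp_Min_less by (metis less_irrefl subsetD)

lemma collection_set_less_iff:
  assumes "collection C" "s \<in> C" "t \<in> C"
  shows "s \<lless> t \<longleftrightarrow> Min s < Min t"
  using assms set_less_imp_Min_less unfolding collection_def by (metis less_asym less_irrefl subsetD)

lemma collection_first:
  assumes "collection C" "C \<noteq> {}"
  obtains t where "t \<in> C" "\<And>x. x \<in> C - {t} \<Longrightarrow> t \<lless> x"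
proof -
  obtain t where t: "t \<in> C" "\<And>x. x \<in> C \<Longrightarrow> Min t \<le> Min x"
    using ex_has_least_nat[of "\<lambda>x. x \<in> C" _ Min] assms(2) by auto
  have "t \<lless> x" if "x \<in> C - {t}" for x
    using collection_set_less_iff[OF assms(1) t(1), of x] collection_Min_inj[OF assms(1)] t that
    by (metis DiffD1 DiffD2 inj_onD le_neq_implies_less singletonI)
  thus thesis using that t(1) by blast
qed

lemma fin_collections_iff: "s \<in> fin_collections \<longleftrightarrow> finite s \<and> collection s"
proof
  assume "s \<in> fin_collections"
  then obtain ss where ss: "s = set ss" "set ss \<subseteq> finsets - {{}}" "sorted_wrt (\<lless>) ss"
    unfolding fin_collections_def disjoint_tuple_def by blast
  have "x \<lless> y \<or> y \<lless> x" if xy: "x \<in> set ss" "y \<in> set ss" "x \<noteq> y" for x y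
  proof -
    obtain i j where "i < length ss" "j < length ss" "x = ss ! i" "y = ss ! j"
      using xy by (metis in_set_conv_nth)
    thus ?thesis using ss(3) xy(3) unfolding sorted_wrt_iff_nth_less
      by (cases i j rule: linorder_cases) auto
  qed
  thus "finite s \<and> collection s" using ss unfolding collection_def by auto
next
  assume "finite s \<and> collection s"
  hence "finite s" "collection s" by auto
  hence "\<exists>ss. disjoint_tuple ss \<and> s = set ss"
  proof (induction s rule: finite_psubset_induct)
    case (psubset s)
    show ?case
    proof (cases "s = {}")
      case True
      thus ?thesis by (intro exI[of _ "[]"]) (auto simp: disjoint_tuple_def)
    next
      case False
      then obtain t where t: "t \<in> s" "\<And>x. x \<in> s - {t} \<Longrightarrow> t \<lless> x"
        using collection_first psubset.prems by metis
      have "s - {t} \<subset> s" using t(1) by blast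
      moreover have "collection (s - {t})" using psubset.prems by (rule collection_subset) blast
      ultimately obtain ss where "disjoint_tuple ss" "s - {t} = set ss" using psubset.IH by metis
      thus ?thesis using t psubset.prems unfolding disjoint_tuple_def collection_def
        by (intro exI[of _ "t # ss"]) auto
    qed
  qed
  thus "s \<in> fin_collections" unfolding fin_collections_def by blast
qed

lemma chain_set_less:
  assumes "\<And>n. s n \<noteq> {}" "\<And>n. s n \<lless> s (Suc n)" "i < j"
  shows "s i \<lless> s (j::nat)"
  using assms(3)
proof (induction j)
  case (Suc j)
  show ?case
  proof (cases "i = j")
    case False
    thus ?thesis using Suc assms(1,2) set_less_trans by (metis less_SucE)
  qed (use assms(2) in auto)
qed simp

lemma inf_collection_range:
  "(\<And>n. s n \<in> finsets - {{}}) \<Longrightarrow> (\<And>n. s n \<lless> s (Suc n)) \<Longrightarrow> inf_collection (range s)"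
  unfolding inf_collection_def by blast

lemma inf_collection_iff: "inf_collection D \<longleftrightarrow> infinite D \<and> collection D"
proof
  assume "inf_collection D"
  then obtain s where s: "\<And>n. s n \<in> finsets - {{}}" "\<And>n. s n \<lless> s (Suc n)" "D = range s"
    unfolding inf_collection_def by blast
  have less: "s i \<lless> s j" if "i < j" for i j
    using s(2) that by (rule chain_set_less[rotated]) (use s(1) in auto)
  have neq: "s i \<noteq> s j" if "i < j" for i j
    using less[OF that] s(1)[of j] set_less_irrefl[of "s j"] by (metis Diff_iff singletonI)
  hence "inj s" unfolding inj_def by (metis linorder_neqE_nat)
  hence "infinite D" using s(3) by (simp add: range_inj_infinite)
  moreover have "collection D"
    unfolding collection_def s(3) using s(1) less by (metis imageE linorder_neqE_nat image_subsetI)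
  ultimately show "infinite D \<and> collection D" ..
next
  assume D: "infinite D \<and> collection D"
  hence inj: "inj_on Min D" by (simp add: collection_Min_inj)
  hence inf: "infinite (Min ` D)" using D finite_imageD by blast
  \<comment> \<open>The members are listed by increasing minima, which identify them; comparability
    turns the order of the minima into \<open>\<lless>\<close>.\<close>
  define s where "s = (\<lambda>n. inv_into D Min (enumerate (Min ` D) n))"
  have s: "s n \<in> D" "Min (s n) = enumerate (Min ` D) n" for n
    using enumerate_in_set[OF inf] by (auto simp: s_def inv_into_into f_inv_into_f)
  have "s n \<lless> s (Suc n)" for n
    using collection_set_less_iff[of D, OF _ s(1) s(1)] D s(2) enumerate_step[OF inf] by simp
  moreover have "range s = D"
  proof
    show "D \<subseteq> range s"
    proof
      fix d assume "d \<in> D"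
      then obtain n where "Min d = enumerate (Min ` D) n"
        using range_enumerate[OF inf] by (metis imageE imageI)
      hence "d = s n" using s[of n] inj \<open>d \<in> D\<close> by (metis inj_onD)
      thus "d \<in> range s" by blast
    qed
  qed (use s in auto)
  ultimately show "inf_collection D"
    using inf_collection_range[of s] s(1) D unfolding collection_def by (metis subsetD)
qed

lemma FU_subset: "D \<subseteq> FU D"
  unfolding FU_def by (auto intro!: exI[of _ "{_}"])

lemma FU_Un: "x \<in> FU D \<Longrightarrow> y \<in> FU D \<Longrightarrow> x \<union> y \<in> FU D"
  unfolding FU_def
proof clarsimp
  fix S T assume "S \<subseteq> D" "finite S" "S \<noteq> {}" "T \<subseteq> D" "finite T" "T \<noteq> {}"
  thus "\<exists>U. \<Union>S \<union> \<Union>T = \<Union>U \<and> U \<subseteq> D \<and> finite U \<and> U \<noteq> {}"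
    by (intro exI[of _ "S \<union> T"]) auto
qed

lemma Union_FU: "finite T \<Longrightarrow> T \<noteq> {} \<Longrightarrow> T \<subseteq> FU D \<Longrightarrow> \<Union>T \<in> FU D"
  by (induction T rule: finite_ne_induct) (auto intro: FU_Un)

lemma FU_FU: "D1 \<subseteq> FU D \<Longrightarrow> FU D1 \<subseteq> FU D"
proof
  fix x assume "D1 \<subseteq> FU D" "x \<in> FU D1"
  then obtain T where "x = \<Union>T" "T \<subseteq> FU D" "finite T" "T \<noteq> {}" unfolding FU_def[of D1] by blast
  thus "x \<in> FU D" using Union_FU by blast
qed

lemma FU_mono: "C \<subseteq> D \<Longrightarrow> FU C \<subseteq> FU D"
  unfolding FU_def by blast

lemma FU_finsets: "D \<subseteq> finsets - {{}} \<Longrightarrow> FU D \<subseteq> finsets - {{}}"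
  unfolding FU_def finsets_def by auto blast+

lemma FU_rangeD:
  assumes "x \<in> FU (range f)"
  obtains I where "finite I" "I \<noteq> {}" "x = (\<Union>i\<in>I. f i)"
proof -
  obtain T where T: "x = \<Union>T" "T \<subseteq> range f" "finite T" "T \<noteq> {}" using assms unfolding FU_def by blast
  obtain I where "finite I" "T = f ` I" using finite_subset_image[OF T(3,2)] by auto
  thus thesis using T that[of I] by auto
qed

lemma UN_in_FU: "finite I \<Longrightarrow> I \<noteq> {} \<Longrightarrow> (\<And>i. i \<in> I \<Longrightarrow> f i \<in> FU D) \<Longrightarrow> (\<Union>i\<in>I. f i) \<in> FU D"
  by (rule Union_FU) auto

lemma inf_collection_finsets: "inf_collection D \<Longrightarrow> D \<subseteq> finsets - {{}}"
  by (auto simp: inf_collection_iff collection_def)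

lemma inf_collection_FU_finsets: "inf_collection D \<Longrightarrow> FU D \<subseteq> finsets - {{}}"
  by (intro FU_finsets inf_collection_finsets)

lemma subcollection_refl: "inf_collection D \<Longrightarrow> D \<sqsubset> D"
  by (simp add: subcollection_def FU_subset)

lemma subcollection_FU: "D1 \<sqsubset> D \<Longrightarrow> FU D1 \<subseteq> FU D"
  by (simp add: subcollection_def FU_FU)

lemma subcollection_trans: "D2 \<sqsubset> D1 \<Longrightarrow> D1 \<sqsubset> D \<Longrightarrow> D2 \<sqsubset> D"
  using subcollection_FU unfolding subcollection_def by blast

lemma subcollection_inf: "D1 \<sqsubset> D \<Longrightarrow> inf_collection D1"
  by (simp add: subcollection_def)

lemma subcollection_range:
  assumes "inf_collection D" "\<And>n. s n \<in> FU D" "\<And>n. s n \<lless> s (Suc n)"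
  shows "range s \<sqsubset> D"
  unfolding subcollection_def
  using assms inf_collection_FU_finsets[OF assms(1)] by (auto intro!: inf_collection_range)

lemma set_less_Un: "s \<union> t \<lless> u \<longleftrightarrow> s \<lless> u \<and> t \<lless> u" "u \<lless> s \<union> t \<longleftrightarrow> u \<lless> s \<and> u \<lless> t"
  by (auto simp: set_less_def)

definition above :: "nat set \<Rightarrow> nat set set \<Rightarrow> nat set set" where
  "above t D = {d \<in> D. t \<lless> d}"

lemma FU_above: "FU (above t D) = {x \<in> FU D. t \<lless> x}"
  unfolding FU_def above_def by (auto simp: set_less_Union)

text \<open>A member that is not above \<open>t\<close> starts at or before \<open>Max t\<close>,
  and members are determined by their minima, so only finitely many are discarded.\<close>

lemma inf_collection_above:
  assumes D: "inf_collection D" and t: "finite t"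
  shows "inf_collection (above t D)"
proof -
  have D': "infinite D" "collection D" using D by (auto simp: inf_collection_iff)
  have "Min d \<le> Max t" if "d \<in> D - above t D" for d
  proof -
    have "d \<in> finsets - {{}}" using that D'(2) by (auto simp: collection_def)
    hence fin: "finite d" by (simp add: finsets_def)
    from that obtain m n where "m \<in> t" "n \<in> d" "n \<le> m" by (auto simp: above_def set_less_def not_less)
    thus ?thesis using Min_le[OF fin, of n] Max_ge[OF t, of m] by simp
  qed
  hence "Min ` (D - above t D) \<subseteq> {..Max t}" by auto
  hence "finite (Min ` (D - above t D))" using finite_subset by blast
  hence "finite (D - above t D)"
    using collection_Min_inj[OF collection_subset[OF D'(2)]] finite_imageD by blast
  moreover have "D = (D - above t D) \<union> above t D" by (auto simp: above_def)
  ultimately have "infinite (above t D)" using D'(1) by (metis finite_UnI)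
  moreover have "collection (above t D)" using D'(2) by (rule collection_subset) (auto simp: above_def)
  ultimately show ?thesis by (simp add: inf_collection_iff)
qed

lemma subcollection_above: "inf_collection D \<Longrightarrow> finite t \<Longrightarrow> above t D \<sqsubset> D"
  unfolding subcollection_def using inf_collection_above FU_subset[of D] by (auto simp: above_def)

text \<open>\<open>T n\<close> stands for a record of all unions of the blocks chosen before stage
  \<open>n\<close>; both constructions by successive choice, the one for Hindman's theorem and the
  fusion, maintain such a record.\<close>

lemma finite_unions_mem:
  assumes T: "\<And>n. insert (s n) ((\<lambda>d. d \<union> s n) ` T n) \<subseteq> T (Suc n)" "\<And>n. T n \<subseteq> T (Suc n)"
    and J: "J \<noteq> {}" "J \<subseteq> {..<n::nat}"
  shows "(\<Union>j\<in>J. s j) \<in> T n"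
  using J
proof (induction n arbitrary: J)
  case (Suc n)
  show ?case
  proof (cases "n \<in> J")
    case True
    show ?thesis
    proof (cases "J = {n}")
      case False
      have "J - {n} \<noteq> {}" "J - {n} \<subseteq> {..<n}" using True False Suc.prems by auto
      hence "(\<Union>j\<in>J - {n}. s j) \<in> T n" by (rule Suc.IH)
      moreover have "(\<Union>j\<in>J. s j) = (\<Union>j\<in>J - {n}. s j) \<union> s n" using True by auto
      ultimately show ?thesis using T(1)[of n] by auto
    qed (use T(1)[of n] in auto)
  next
    case False
    hence "J \<subseteq> {..<n}" using Suc.prems(2) by (auto simp: less_Suc_eq)
    thus ?thesis using Suc.IH Suc.prems(1) T(2) by blast
  qed
qed auto

section \<open>Large sets and Hindman's theorem\<close>

definition large :: "nat set set \<Rightarrow> nat set set \<Rightarrow> bool" where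
  "large X D \<longleftrightarrow> (\<forall>D'. D' \<sqsubset> D \<longrightarrow> X \<inter> FU D' \<noteq> {})"

text \<open>Partition regularity: if one piece is not large, some subcollection avoids it, and there
  the union of the remaining pieces is still large.\<close>

lemma large_UN:
  assumes "finite I" "large (\<Union>i\<in>I. X i) D" "inf_collection D"
  shows "\<exists>i\<in>I. \<exists>D'. D' \<sqsubset> D \<and> large (X i) D'"
  using assms
proof (induction I arbitrary: D)
  case empty
  thus ?case using subcollection_refl unfolding large_def by auto
next
  case (insert i I)
  show ?case
  proof (cases "large (X i) D")
    case True
    thus ?thesis using insert.prems subcollection_refl by blast
  next
    case False
    then obtain D1 where D1: "D1 \<sqsubset> D" "X i \<inter> FU D1 = {}" unfolding large_def by blast
    have "large (\<Union>i\<in>I. X i) D1" unfolding large_def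
    proof (intro allI impI)
      fix D2 assume D2: "D2 \<sqsubset> D1"
      hence "(\<Union>i\<in>insert i I. X i) \<inter> FU D2 \<noteq> {}"
        using insert.prems(1) D1(1) subcollection_trans unfolding large_def by blast
      moreover have "X i \<inter> FU D2 = {}" using D1(2) subcollection_FU[OF D2] by blast
      ultimately show "(\<Union>i\<in>I. X i) \<inter> FU D2 \<noteq> {}" by auto
    qed
    then obtain j D' where "j \<in> I" "D' \<sqsubset> D1" "large (X j) D'"
      using insert.IH subcollection_inf[OF D1(1)] by blast
    thus ?thesis using D1(1) subcollection_trans by blast
  qed
qed

text \<open>If the lemma failed, one could choose successive blocks such that no union of at least two of
  them is in \<open>X\<close>; merging the blocks in pairs contradicts largeness.\<close>

lemma large_finite_translates:
  assumes D: "inf_collection D" and X: "large X D"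
  shows "\<exists>E. finite E \<and> E \<subseteq> FU D \<and> (\<forall>s\<in>FU D. (\<forall>e\<in>E. e \<lless> s) \<longrightarrow> (\<exists>e\<in>E. e \<union> s \<in> X))"
proof (rule ccontr)
  assume neg: "\<not> ?thesis"
  have step: "\<exists>s\<in>FU D. (\<forall>e\<in>E. e \<lless> s) \<and> (\<forall>e\<in>E. e \<union> s \<notin> X)" if "finite E" "E \<subseteq> FU D" for E
    using neg[unfolded not_ex, THEN spec, of E] that by simp
  define P where "P = (\<lambda>E. finite E \<and> E \<subseteq> FU D)"
  \<comment> \<open>Adding \<open>s\<close> and all \<open>d \<union> s\<close> keeps every union of
    the chosen blocks in the finite set, so that the next block is tested against each of
    them.\<close>
  define Q where "Q = (\<lambda>E E'. \<exists>s\<in>FU D. (\<forall>e\<in>E. e \<lless> s) \<and> (\<forall>e\<in>E. e \<union> s \<notin> X) \<and>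
    E' = E \<union> insert s ((\<lambda>d. d \<union> s) ` E))"
  obtain T where T: "\<And>n. P (T n)" "\<And>n. Q (T n) (T (Suc n))"
  proof (rule dependent_nat_choice[of "\<lambda>_. P" "\<lambda>_. Q", THEN exE])
    show "\<exists>x. P x" unfolding P_def by blast
    show "\<exists>E'. P E' \<and> Q E E'" if E: "P E" for E
    proof -
      obtain s where s: "s \<in> FU D" "\<forall>e\<in>E. e \<lless> s" "\<forall>e\<in>E. e \<union> s \<notin> X"
        using step E unfolding P_def by blast
      hence "P (E \<union> insert s ((\<lambda>d. d \<union> s) ` E))" using E FU_Un unfolding P_def by auto
      thus ?thesis using s unfolding Q_def by blast
    qed
  qed blast
  then obtain s where s: "\<And>n. s n \<in> FU D" "\<And>n e. e \<in> T n \<Longrightarrow> e \<lless> s n"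
      "\<And>n e. e \<in> T n \<Longrightarrow> e \<union> s n \<notin> X"
    and Suc: "\<And>n. T (Suc n) = T n \<union> insert (s n) ((\<lambda>d. d \<union> s n) ` T n)"
    unfolding Q_def by metis
  have less: "s n \<lless> s (Suc n)" for n using s(2) Suc by blast
  have ne: "s n \<noteq> {}" for n using s(1) inf_collection_FU_finsets[OF D] by blast
  \<comment> \<open>In a union of pairs the last block \<open>s (2 * m + 1)\<close> is always
    preceded by another one, \<open>s (2 * m)\<close>; a single block might well lie in
    \<open>X\<close>.\<close>
  define D' where "D' = range (\<lambda>n. s (2 * n) \<union> s (2 * n + 1))"
  have "D' \<sqsubset> D" unfolding D'_def
  proof (rule subcollection_range[OF D])
    show "s (2 * n) \<union> s (2 * n + 1) \<in> FU D" for n using s(1) by (intro FU_Un)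
    show "s (2 * n) \<union> s (2 * n + 1) \<lless> s (2 * Suc n) \<union> s (2 * Suc n + 1)" for n
      unfolding set_less_Un by (intro conjI chain_set_less[of s, OF ne less]) simp_all
  qed
  then obtain x where x: "x \<in> X" "x \<in> FU D'" using X unfolding large_def by blast
  obtain I where I: "finite I" "I \<noteq> {}" "x = (\<Union>n\<in>I. s (2 * n) \<union> s (2 * n + 1))"
    using x(2) unfolding D'_def by (rule FU_rangeD)
  define m where "m = Max I"
  \<comment> \<open>The indices of all blocks of \<open>x\<close> except the very last,
    \<open>2 * m + 1\<close>.\<close>
  define J where "J = (*) 2 ` I \<union> (\<lambda>n. 2 * n + 1) ` (I - {m})"
  have m: "m \<in> I" "\<And>n. n \<in> I \<Longrightarrow> n \<le> m" using I(1,2) by (auto simp: m_def)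
  have "(\<Union>j\<in>J. s j) \<in> T (2 * m + 1)"
  proof (rule finite_unions_mem)
    show "J \<subseteq> {..<2 * m + 1}"
    proof
      fix j assume "j \<in> J"
      then consider n where "n \<in> I" "j = 2 * n" | n where "n \<in> I" "n \<noteq> m" "j = 2 * n + 1"
        unfolding J_def by auto
      thus "j \<in> {..<2 * m + 1}"
      proof cases
        case (1 n)
        thus ?thesis using m(2)[of n] by simp
      next
        case (2 n)
        thus ?thesis using m(2)[of n] by simp
      qed
    qed
  qed (use Suc m(1) in \<open>auto simp: J_def\<close>)
  hence "(\<Union>j\<in>J. s j) \<union> s (2 * m + 1) \<notin> X" by (rule s(3))
  moreover have "(\<Union>j\<in>J. s j) \<union> s (2 * m + 1) = x"
    unfolding I(3) J_def using m(1) by (auto split: if_splits)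
  ultimately show False using x(1) by simp
qed

text \<open>On a tail beyond the finite set \<open>E\<close>, the set \<open>X\<close> is covered by
  the pieces \<open>{s \<in> X. e \<union> s \<in> X}\<close> with \<open>e \<in> E\<close>; by
  partition regularity one of them is large below some subcollection.\<close>

lemma large_translate:
  assumes D: "inf_collection D" and X: "large X D"
  shows "\<exists>d\<in>FU D. \<exists>D'. D' \<sqsubset> D \<and> (\<forall>x\<in>FU D'. d \<lless> x) \<and> large {s \<in> X. d \<union> s \<in> X} D'"
proof -
  obtain E where E: "finite E" "E \<subseteq> FU D" "\<And>s. s \<in> FU D \<Longrightarrow> \<forall>e\<in>E. e \<lless> s \<Longrightarrow> \<exists>e\<in>E. e \<union> s \<in> X"
    using large_finite_translates[OF assms] by blast
  have "finite (\<Union>E)" using E(1,2) inf_collection_FU_finsets[OF D] by (auto simp: finsets_def)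
  hence D1: "above (\<Union>E) D \<sqsubset> D" (is "?D1 \<sqsubset> D") by (rule subcollection_above[OF D])
  have below: "e \<lless> s" if "s \<in> FU ?D1" "e \<in> E" for e s
    using that unfolding FU_above set_less_Union_left by blast
  have "large (\<Union>e\<in>E. {s \<in> X. e \<union> s \<in> X}) ?D1"
    unfolding large_def
  proof (intro allI impI)
    fix D2 assume D2: "D2 \<sqsubset> ?D1"
    then obtain s where s: "s \<in> X" "s \<in> FU D2"
      using X D1 subcollection_trans unfolding large_def by blast
    have "s \<in> FU ?D1" using subcollection_FU[OF D2] s(2) by blast
    hence "\<exists>e\<in>E. e \<union> s \<in> X" using E(3)[of s] below subcollection_FU[OF D1] by blast
    thus "(\<Union>e\<in>E. {s \<in> X. e \<union> s \<in> X}) \<inter> FU D2 \<noteq> {}" using s by blast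
  qed
  then obtain d D' where "d \<in> E" "D' \<sqsubset> ?D1" "large {s \<in> X. d \<union> s \<in> X} D'"
    using large_UN[OF E(1)] subcollection_inf[OF D1] by blast
  thus ?thesis using E(2) below subcollection_FU subcollection_trans[OF _ D1] by blast
qed

text \<open>Repeated translation gives blocks \<open>d n\<close> and shrinking sets
  \<open>Y n\<close> such that a member of \<open>Y m\<close> may be joined with any union of
  earlier blocks without leaving \<open>X\<close>. The \<open>d n\<close> need not lie in
  \<open>X\<close> themselves; they are the material for the final blocks
  \<open>c i\<close>.\<close>

lemma large_contains_FU:
  assumes D: "inf_collection D" and X: "large X D"
  shows "\<exists>D'. D' \<sqsubset> D \<and> FU D' \<subseteq> X"
proof -
  \<comment> \<open>The clause for index 0 fixes the starting pair, which the choice principle would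
    otherwise leave open.\<close>
  define P where "P = (\<lambda>n (Y, E). inf_collection E \<and> large Y E \<and> (n = (0::nat) \<longrightarrow> Y = X \<and> E = D))"
  define Q where "Q = (\<lambda>(Y, E) (Y', E'). \<exists>d\<in>FU E. E' \<sqsubset> E \<and> (\<forall>x\<in>FU E'. d \<lless> x) \<and>
    Y' = {s \<in> Y. d \<union> s \<in> (Y :: nat set set)})"
  obtain f where f: "\<And>n. P n (f n)" "\<And>n. Q (f n) (f (Suc n))"
  proof (rule dependent_nat_choice[of P "\<lambda>_. Q", THEN exE])
    show "\<exists>x. P 0 x" unfolding P_def using D X by auto
    show "\<exists>y. P (Suc n) y \<and> Q x y" if "P n x" for n x
    proof -
      obtain Y E where x: "x = (Y, E)" by fastforce
      have "inf_collection E" "large Y E" using that by (auto simp: P_def x)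
      then obtain d D' where "d \<in> FU E" "D' \<sqsubset> E" "\<forall>x\<in>FU D'. d \<lless> x" "large {s \<in> Y. d \<union> s \<in> Y} D'"
        using large_translate by blast
      hence "P (Suc n) ({s \<in> Y. d \<union> s \<in> Y}, D') \<and> Q x ({s \<in> Y. d \<union> s \<in> Y}, D')"
        using subcollection_inf unfolding P_def Q_def x by auto
      thus ?thesis by blast
    qed
  qed blast
  define Y E where "Y n = fst (f n)" and "E n = snd (f n)" for n
  have YE: "inf_collection (E n)" "large (Y n) (E n)" for n
    using f(1)[of n] unfolding P_def Y_def E_def by (auto simp: case_prod_beta)
  have YE0: "Y 0 = X" "E 0 = D" using f(1)[of 0] unfolding P_def Y_def E_def by (auto simp: case_prod_beta)
  have "\<forall>n. \<exists>d\<in>FU (E n). E (Suc n) \<sqsubset> E n \<and> (\<forall>x\<in>FU (E (Suc n)). d \<lless> x) \<and>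
      Y (Suc n) = {s \<in> Y n. d \<union> s \<in> Y n}"
    using f(2) unfolding Q_def Y_def E_def by (auto simp: case_prod_beta)
  then obtain d where d: "\<And>n. d n \<in> FU (E n)" "\<And>n x. x \<in> FU (E (Suc n)) \<Longrightarrow> d n \<lless> x"
    and E_Suc: "\<And>n. E (Suc n) \<sqsubset> E n" and Y_Suc: "\<And>n. Y (Suc n) = {s \<in> Y n. d n \<union> s \<in> Y n}"
    by metis
  have E_mono: "E (k + n) \<sqsubset> E k" for k n
  proof (induction n)
    case (Suc n)
    thus ?case using subcollection_trans[OF E_Suc] by simp
  qed (simp add: subcollection_refl YE(1))
  have d_ne: "d n \<noteq> {}" for n using d(1) inf_collection_FU_finsets[OF YE(1)] by blast
  have d_less: "d i \<lless> d j" if "i < j" for i j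
    by (rule chain_set_less[OF d_ne _ that]) (use d in auto)
  have Y_union: "(\<Union>j\<in>K. d j) \<union> x \<in> X" if "K \<subseteq> {..<m}" "x \<in> Y m" for K m x
    using that
  proof (induction m arbitrary: K x)
    case 0
    thus ?case by (simp add: YE0)
  next
    case (Suc m)
    show ?case
    proof (cases "m \<in> K")
      case True
      have "K - {m} \<subseteq> {..<m}" using Suc.prems(1) by auto
      hence "(\<Union>j\<in>K - {m}. d j) \<union> (d m \<union> x) \<in> X"
        using Suc.prems(2) by (intro Suc.IH) (auto simp: Y_Suc)
      moreover have "(\<Union>j\<in>K - {m}. d j) \<union> (d m \<union> x) = (\<Union>j\<in>K. d j) \<union> x" using True by auto
      ultimately show ?thesis by simp
    next
      case False
      hence "K \<subseteq> {..<m}" using Suc.prems(1) by (auto simp: less_Suc_eq)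
      thus ?thesis using Suc.prems(2) by (intro Suc.IH) (auto simp: Y_Suc)
    qed
  qed
  \<comment> \<open>Largeness of \<open>Y k\<close>, applied to the collection of the blocks from
    index \<open>k\<close> on, provides a union of them that lies in \<open>Y k\<close>.\<close>
  have "\<exists>J. finite J \<and> J \<noteq> {} \<and> J \<subseteq> {k..} \<and> (\<Union>j\<in>J. d j) \<in> Y k" for k
  proof -
    have "range (\<lambda>n. d (k + n)) \<sqsubset> E k"
    proof (rule subcollection_range[OF YE(1)])
      show "d (k + n) \<in> FU (E k)" for n using d(1) subcollection_FU[OF E_mono] by blast
    qed (simp add: d_less)
    then obtain x where x: "x \<in> Y k" "x \<in> FU (range (\<lambda>n. d (k + n)))"
      using YE(2)[of k] unfolding large_def by blast
    obtain I where "finite I" "I \<noteq> {}" "x = (\<Union>n\<in>I. d (k + n))" using x(2) by (rule FU_rangeD)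
    thus ?thesis using x(1) by (intro exI[of _ "(+) k ` I"]) auto
  qed
  then obtain J where J: "\<And>k. finite (J k)" "\<And>k. J k \<noteq> {}" "\<And>k. J k \<subseteq> {k..}"
      "\<And>k. (\<Union>j\<in>J k. d j) \<in> Y k"
    by metis
  \<comment> \<open>The next start lies just beyond the indices already used, so the sets
    \<open>J (k i)\<close> are successive.\<close>
  define k where "k = rec_nat 0 (\<lambda>_ i. Suc (Max (J i)))"
  have k_Suc: "k (Suc i) = Suc (Max (J (k i)))" for i by (simp add: k_def)
  have J_less: "J (k i) \<subseteq> {..<k (Suc i)}" for i
    using J(1) by (auto simp: k_Suc less_Suc_eq_le)
  have "k i < k (Suc i)" for i using J_less[of i] J(2,3)[of "k i"] by fastforce
  hence "strict_mono k" by (simp add: strict_mono_Suc_iff)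
  hence k_le: "k i \<le> k j" if "i \<le> j" for i j using that by (simp add: strict_mono_less_eq)
  define c where "c i = (\<Union>j\<in>J (k i). d j)" for i
  have dD: "d n \<in> FU D" for n using d(1)[of n] subcollection_FU[OF E_mono[of 0 n]] YE0(2) by auto
  have "range c \<sqsubset> D"
  proof (rule subcollection_range[OF D])
    show "c i \<in> FU D" for i unfolding c_def using J(1,2) dD by (intro UN_in_FU)
    show "c i \<lless> c (Suc i)" for i
      unfolding c_def set_less_Union set_less_Union_left
      using J_less[of i] J(3)[of "k (Suc i)"]
      by (auto intro!: d_less) (metis atLeast_iff lessThan_iff order_less_le_trans subsetD)
  qed
  moreover have "FU (range c) \<subseteq> X"
  proof
    fix x assume "x \<in> FU (range c)"
    then obtain I where I: "finite I" "I \<noteq> {}" "x = (\<Union>i\<in>I. c i)" by (rule FU_rangeD)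
    define m where "m = Max I"
    have m: "m \<in> I" "\<And>n. n \<in> I \<Longrightarrow> n \<le> m" using I(1,2) by (auto simp: m_def)
    \<comment> \<open>The last block \<open>c m\<close> lies in \<open>Y (k m)\<close>, and the
      other blocks are unions of \<open>d j\<close> with \<open>j < k m\<close>; this is exactly
      what \<open>Y_union\<close> asks for.\<close>
    have "(\<Union>i\<in>I - {m}. J (k i)) \<subseteq> {..<k m}"
    proof (rule UN_least)
      fix i assume "i \<in> I - {m}"
      hence "Suc i \<le> m" using m(2)[of i] by auto
      thus "J (k i) \<subseteq> {..<k m}" using J_less[of i] k_le[of "Suc i" m] by auto
    qed
    hence "(\<Union>j\<in>(\<Union>i\<in>I - {m}. J (k i)). d j) \<union> c m \<in> X"
      using J(4)[of "k m"] unfolding c_def by (rule Y_union)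
    moreover have "(\<Union>j\<in>(\<Union>i\<in>I - {m}. J (k i)). d j) \<union> c m = x"
      using m(1) unfolding I(3) c_def by auto
    ultimately show "x \<in> X" by simp
  qed
  ultimately show ?thesis by blast
qed

text \<open>If \<open>X\<close> is not large, the witness is already a subcollection whose unions
  avoid \<open>X\<close>; the work lies in the large case.\<close>

theorem Hindman:
  assumes D: "inf_collection D"
  shows "\<exists>D'. D' \<sqsubset> D \<and> (FU D' \<subseteq> X \<or> FU D' \<inter> X = {})"
proof (cases "large X D")
  case True
  thus ?thesis using large_contains_FU[OF D] by blast
next
  case False
  thus ?thesis unfolding large_def by blast
qed

text \<open>Diagonalisation: at each stage there are only finitely many unions of chosen blocks, so
  \<open>E\<close> can be shrunk until \<open>Q\<close> holds for all of them before the next block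
  is taken from it. Blocks beyond \<open>t\<close> thus come from a collection that is good for
  \<open>t\<close>.\<close>

lemma fusion:
  assumes D: "inf_collection D"
    and hered: "\<And>t E E'. Q t E \<Longrightarrow> E' \<sqsubset> E \<Longrightarrow> Q t E'"
    and dense: "\<And>t E. t \<in> FU D \<Longrightarrow> E \<sqsubset> D \<Longrightarrow> \<exists>E'. E' \<sqsubset> E \<and> Q t E'"
  shows "\<exists>D1. D1 \<sqsubset> D \<and> (\<forall>t\<in>FU D1. Q t (above t D1))"
proof -
  have dense_finite: "\<exists>E'. E' \<sqsubset> E \<and> (\<forall>t\<in>T. Q t E')" if "finite T" "T \<subseteq> FU D" "E \<sqsubset> D" for T E
    using that
  proof (induction T)
    case empty
    thus ?case using subcollection_refl subcollection_inf by blast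
  next
    case (insert t T)
    then obtain E1 where E1: "E1 \<sqsubset> E" "\<forall>t\<in>T. Q t E1" by blast
    obtain E2 where E2: "E2 \<sqsubset> E1" "Q t E2"
      using dense[of t E1] subcollection_trans[OF E1(1)] insert.prems by blast
    thus ?case using E1 hered subcollection_trans by blast
  qed
  define P where "P = (\<lambda>(T, E). finite T \<and> T \<subseteq> FU D \<and> E \<sqsubset> D \<and> (\<forall>t\<in>T. Q t E))"
  define R where "R = (\<lambda>(T, E) (T', E'). \<exists>d\<in>FU E. E' \<sqsubset> above d E \<and>
    T' = T \<union> insert d ((\<lambda>t. t \<union> d) ` T))"
  obtain f where f: "\<And>n. P (f n)" "\<And>n. R (f n) (f (Suc n))"
  proof (rule dependent_nat_choice[of "\<lambda>_. P" "\<lambda>_. R", THEN exE])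
    show "\<exists>x. P x" unfolding P_def using subcollection_refl[OF D] by (intro exI[of _ "({}, D)"]) auto
    show "\<exists>y. P y \<and> R x y" if "P x" for x
    proof -
      obtain T E where x: "x = (T, E)" by fastforce
      have TE: "finite T" "T \<subseteq> FU D" "E \<sqsubset> D" using that by (auto simp: P_def x)
      have E: "inf_collection E" using subcollection_inf[OF TE(3)] .
      then obtain d where d: "d \<in> E" by (metis inf_collection_iff finite.emptyI ex_in_conv)
      have dE: "d \<in> FU E" using FU_subset d by blast
      hence dD: "d \<in> FU D" using subcollection_FU[OF TE(3)] by blast
      have "finite d" using inf_collection_finsets[OF E] d by (auto simp: finsets_def)
      hence ab: "above d E \<sqsubset> E" by (rule subcollection_above[OF E])
      have "\<exists>E'. E' \<sqsubset> above d E \<and> (\<forall>t\<in>T \<union> insert d ((\<lambda>t. t \<union> d) ` T). Q t E')"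
        using TE dD FU_Un subcollection_trans[OF ab TE(3)] by (intro dense_finite) auto
      then obtain E' where E': "E' \<sqsubset> above d E" "\<forall>t\<in>T \<union> insert d ((\<lambda>t. t \<union> d) ` T). Q t E'" by blast
      hence "E' \<sqsubset> D" using subcollection_trans ab TE(3) by blast
      hence "P (T \<union> insert d ((\<lambda>t. t \<union> d) ` T), E')"
        using TE dD FU_Un E'(2) unfolding P_def by auto
      moreover have "R x (T \<union> insert d ((\<lambda>t. t \<union> d) ` T), E')"
        using E'(1) dE unfolding R_def x by blast
      ultimately show ?thesis by blast
    qed
  qed blast
  define T E where "T n = fst (f n)" and "E n = snd (f n)" for n
  have TE: "E n \<sqsubset> D" "\<And>t. t \<in> T n \<Longrightarrow> Q t (E n)" for n
    using f(1)[of n] unfolding P_def T_def E_def by (auto simp: case_prod_beta)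
  have "\<forall>n. \<exists>d\<in>FU (E n). E (Suc n) \<sqsubset> above d (E n) \<and> T (Suc n) = T n \<union> insert d ((\<lambda>t. t \<union> d) ` T n)"
    using f(2) unfolding R_def T_def E_def by (auto simp: case_prod_beta)
  then obtain d where d: "\<And>n. d n \<in> FU (E n)" "\<And>n. E (Suc n) \<sqsubset> above (d n) (E n)"
    and T_Suc: "\<And>n. T (Suc n) = T n \<union> insert (d n) ((\<lambda>t. t \<union> d n) ` T n)"
    by metis
  have E_Suc: "FU (E (Suc n)) \<subseteq> {x \<in> FU (E n). d n \<lless> x}" for n
    using subcollection_FU[OF d(2)] FU_above by metis
  have E_mono: "FU (E (k + n)) \<subseteq> FU (E k)" for k n
    by (induction n) (use E_Suc in auto)
  have D1: "range d \<sqsubset> D"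
    using d(1) E_Suc subcollection_FU[OF TE(1)] by (intro subcollection_range[OF D]) blast+
  have "Q t (above t (range d))" if t: "t \<in> FU (range d)" for t
  proof -
    obtain I where I: "finite I" "I \<noteq> {}" "t = (\<Union>i\<in>I. d i)" using t by (rule FU_rangeD)
    define m where "m = Max I"
    have m: "m \<in> I" "\<And>n. n \<in> I \<Longrightarrow> n \<le> m" using I(1,2) by (auto simp: m_def)
    have "(\<Union>i\<in>I. d i) \<in> T (Suc m)"
    proof (rule finite_unions_mem)
      show "I \<subseteq> {..<Suc m}" using m(2) by (auto simp: less_Suc_eq_le)
    qed (use T_Suc I(2) in auto)
    hence Qt: "Q t (E (Suc m))" using TE(2) I(3) by simp
    have ne: "d n \<noteq> {}" for n
      using d(1) inf_collection_FU_finsets[OF subcollection_inf[OF TE(1)]] by blast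
    have "x \<in> FU (E (Suc m))" if x: "x \<in> above t (range d)" for x
    proof -
      obtain j where j: "x = d j" "t \<lless> d j" using x unfolding above_def by blast
      \<comment> \<open>\<open>t\<close> contains \<open>d m\<close>, so a block beyond
        \<open>t\<close> has an index greater than \<open>m\<close> and was chosen from inside
        \<open>E (Suc m)\<close>.\<close>
      have "j \<noteq> i" if "i \<le> m" for i
      proof
        assume "j = i"
        have "d m \<lless> d j" using j(2) m(1) unfolding I(3) set_less_Union_left by blast
        moreover have "d j \<lless> d m \<or> j = m"
          using chain_set_less[of d j m] ne d E_Suc that \<open>j = i\<close>
          by (metis (no_types, lifting) le_neq_implies_less mem_Collect_eq subsetD)
        ultimately show False using ne set_less_asym set_less_irrefl by metis
      qed
      hence "Suc m \<le> j" by (metis not_less_eq_eq)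
      then obtain k where "j = Suc m + k" using le_Suc_ex by blast
      thus ?thesis using d(1)[of j] E_mono[of "Suc m" k] j(1) by auto
    qed
    moreover have "finite t" using t inf_collection_FU_finsets[OF subcollection_inf[OF D1]] by (auto simp: finsets_def)
    ultimately have "above t (range d) \<sqsubset> E (Suc m)"
      using inf_collection_above[OF subcollection_inf[OF D1]] subcollection_inf[OF TE(1)]
      unfolding subcollection_def by blast
    thus ?thesis using hered Qt by blast
  qed
  thus ?thesis using D1 by blast
qed

section \<open>Block families over a collection and their Ramsey theorem\<close>

lemma fin_collections_in_iff:
  "s \<in> fin_collections_in D \<longleftrightarrow> finite s \<and> collection s \<and> s \<subseteq> FU D"
  by (auto simp: fin_collections_in_def fin_collections_iff)

lemma fin_collections_in_mono: "D1 \<sqsubset> D \<Longrightarrow> fin_collections_in D1 \<subseteq> fin_collections_in D"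
  using subcollection_FU by (auto simp: fin_collections_in_def)

text \<open>For \<open>m = 0\<close> and a Schreier family this is the block Schreier family over
  \<open>D\<close>; the bound \<open>m\<close> follows the parameter of \<open>uniform\<close>, so
  that the induction can pass to quotients.\<close>

definition blocks_over :: "nat \<Rightarrow> nat set set \<Rightarrow> nat set set \<Rightarrow> nat set set set" where
  "blocks_over m A D = {s \<in> fin_collections_in D. (\<forall>x\<in>s. {m} \<lless> x) \<and> Min ` s \<in> A}"

lemma blocks_over_mono: "D1 \<sqsubset> D \<Longrightarrow> blocks_over m A D1 \<subseteq> blocks_over m A D"
  using fin_collections_in_mono unfolding blocks_over_def by blast

lemma set_less_Min:
  assumes "t \<lless> x" "t \<in> finsets - {{}}" shows "{Min t} \<lless> x"
  using assms finsetsD[OF assms(2)] Min_in unfolding set_less_def by auto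

text \<open>Removing the first block \<open>t\<close> removes the least element \<open>Min t\<close>
  from the set of minima, which is how quotients of \<open>A\<close> enter arguments about
  blocks.\<close>

lemma blocks_over_first:
  assumes s: "s \<in> blocks_over m A D" and A: "{} \<notin> A"
  obtains t where "t \<in> s" "t \<in> FU D" "m < Min t" "\<And>x. x \<in> s - {t} \<Longrightarrow> t \<lless> x"
    "s - {t} \<in> blocks_over (Min t) (quotient_at (Min t) A) (above t D)"
proof -
  have s': "finite s" "collection s" "s \<subseteq> FU D" "\<And>x. x \<in> s \<Longrightarrow> {m} \<lless> x" "Min ` s \<in> A"
    using s by (auto simp: blocks_over_def fin_collections_in_iff)
  have "s \<noteq> {}" using s'(5) A by auto
  then obtain t where t: "t \<in> s" "\<And>x. x \<in> s - {t} \<Longrightarrow> t \<lless> x" using collection_first[OF s'(2)] by metis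
  have tf: "t \<in> finsets - {{}}" using s'(2) t(1) by (auto simp: collection_def)
  hence mt: "m < Min t" using s'(4)[OF t(1)] finsetsD[OF tf] Min_in by (auto simp: set_less_def)
  have "Min t < Min x" if "x \<in> s - {t}" for x
    using t(2)[OF that] tf that s'(2) by (intro set_less_imp_Min_less) (auto simp: collection_def)
  hence "{Min t} \<lless> Min ` (s - {t})" by (auto simp: set_less_def)
  moreover have "insert (Min t) (Min ` (s - {t})) = Min ` s" using t(1) by auto
  ultimately have "Min ` (s - {t}) \<in> quotient_at (Min t) A" using s'(5) by (simp add: quotient_at_def)
  moreover have "s - {t} \<in> fin_collections_in (above t D)"
    unfolding fin_collections_in_iff FU_above
    using s' t(2) collection_subset[OF s'(2), of "s - {t}"] by auto
  ultimately have "s - {t} \<in> blocks_over (Min t) (quotient_at (Min t) A) (above t D)"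
    using t(2) tf set_less_Min unfolding blocks_over_def by blast
  thus thesis using that t mt s'(3) by blast
qed

text \<open>For one first block \<open>t\<close>, the induction hypothesis at the quotient by
  \<open>Min t\<close> decides whether its continuations enter \<open>G\<close>; fusion decides this
  for all first blocks at once, and Hindman's theorem makes the decision the same for all of
  them.\<close>

theorem block_Ramsey:
  assumes "uniform m \<xi> A" "inf_collection D"
  shows "\<exists>D1. D1 \<sqsubset> D \<and> (blocks_over m A D1 \<subseteq> G \<or> blocks_over m A D1 \<inter> G = {})"
  using assms
proof (induction arbitrary: D G)
  case (zero m)
  have "blocks_over m {{}} D \<subseteq> {{}}" by (auto simp: blocks_over_def)
  thus ?case using subcollection_refl[OF zero] by blast
next
  case (step \<xi> A m r)
  let ?B = "\<lambda>t. blocks_over (Min t) (quotient_at (Min t) A)"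
  \<comment> \<open>For \<open>Min t \<le> m\<close> the quotient is not known to be uniform, so
    \<open>Q\<close> is vacuous there; no member of \<open>blocks_over m A D\<close> begins with
    such a block.\<close>
  define Q where "Q t E \<longleftrightarrow> (m < Min t \<longrightarrow> ?B t E \<subseteq> {s. insert t s \<in> G} \<or> ?B t E \<inter> {s. insert t s \<in> G} = {})"
    for t E
  have "\<exists>D1. D1 \<sqsubset> D \<and> (\<forall>t\<in>FU D1. Q t (above t D1))"
  proof (rule fusion[OF step.prems])
    show "Q t E'" if "Q t E" "E' \<sqsubset> E" for t E E'
      using that blocks_over_mono[OF that(2)] unfolding Q_def by blast
    show "\<exists>E'. E' \<sqsubset> E \<and> Q t E'" if "t \<in> FU D" "E \<sqsubset> D" for t E
    proof (cases "m < Min t")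
      case True
      thus ?thesis using step.IH[OF True subcollection_inf[OF that(2)]] unfolding Q_def by blast
    next
      case False
      thus ?thesis using subcollection_refl subcollection_inf[OF that(2)] unfolding Q_def by blast
    qed
  qed
  then obtain D1 where D1: "D1 \<sqsubset> D" "\<And>t. t \<in> FU D1 \<Longrightarrow> Q t (above t D1)" by blast
  obtain D2 where D2: "D2 \<sqsubset> D1"
    "FU D2 \<subseteq> {t. ?B t (above t D1) \<subseteq> {s. insert t s \<in> G}} \<or>
     FU D2 \<inter> {t. ?B t (above t D1) \<subseteq> {s. insert t s \<in> G}} = {}"
    using Hindman[OF subcollection_inf[OF D1(1)]] by blast
  \<comment> \<open>The block \<open>t\<close> is taken over \<open>D2\<close>, but its continuation
    is viewed over the tail of \<open>D1\<close>, where fusion has decided it.\<close>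
  have decomp: "\<exists>t\<in>FU D2. s = insert t (s - {t}) \<and> m < Min t \<and> s - {t} \<in> ?B t (above t D1)"
    if "s \<in> blocks_over m A D2" for s
  proof -
    have "s \<in> blocks_over m A D1" using that blocks_over_mono[OF D2(1)] by blast
    from this \<open>{} \<notin> A\<close> obtain t where "t \<in> s" "m < Min t" "s - {t} \<in> ?B t (above t D1)"
      by (rule blocks_over_first)
    moreover have "t \<in> FU D2" using that calculation(1) by (auto simp: blocks_over_def fin_collections_in_iff)
    moreover have "s = insert t (s - {t})" using calculation(1) by blast
    ultimately show ?thesis by blast
  qed
  have "blocks_over m A D2 \<subseteq> G \<or> blocks_over m A D2 \<inter> G = {}"
    using D2(2)
  proof
    assume hom: "FU D2 \<subseteq> {t. ?B t (above t D1) \<subseteq> {s. insert t s \<in> G}}"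
    have "s \<in> G" if "s \<in> blocks_over m A D2" for s
    proof -
      obtain t where t: "t \<in> FU D2" "s = insert t (s - {t})" "s - {t} \<in> ?B t (above t D1)"
        using decomp[OF \<open>s \<in> _\<close>] by blast
      have "insert t (s - {t}) \<in> G" using hom t(1,3) by blast
      thus ?thesis using t(2) by simp
    qed
    thus ?thesis by blast
  next
    assume hom: "FU D2 \<inter> {t. ?B t (above t D1) \<subseteq> {s. insert t s \<in> G}} = {}"
    have "s \<notin> G" if "s \<in> blocks_over m A D2" for s
    proof -
      obtain t where t: "t \<in> FU D2" "s = insert t (s - {t})" "m < Min t" "s - {t} \<in> ?B t (above t D1)"
        using decomp[OF \<open>s \<in> _\<close>] by blast
      have "Q t (above t D1)" using D1(2) t(1) subcollection_FU[OF D2(1)] by blast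
      hence "?B t (above t D1) \<inter> {s. insert t s \<in> G} = {}" using hom t(1,3) unfolding Q_def by blast
      hence "insert t (s - {t}) \<notin> G" using t(4) by blast
      thus ?thesis using t(2) by simp
    qed
    thus ?thesis by blast
  qed
  thus ?case using subcollection_trans[OF D2(1) D1(1)] by blast
qed

section \<open>Derivatives and block families\<close>

lemma hereditaryD:
  "hereditary F \<Longrightarrow> s \<in> F \<Longrightarrow> t \<in> fin_collections \<Longrightarrow> t \<subseteq> FU s \<Longrightarrow> t \<in> F"
  unfolding hereditary_def lower_star_def by blast

lemma hereditary_subset:
  assumes "F \<subseteq> fin_collections" "hereditary F" "s \<in> F" "t \<subseteq> s"
  shows "t \<in> F"
proof (rule hereditaryD[OF assms(2,3)])
  have "finite s" "collection s" using assms(1,3) by (auto simp: fin_collections_iff)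
  thus "t \<in> fin_collections"
    using collection_subset assms(4) finite_subset unfolding fin_collections_iff by blast
  show "t \<subseteq> FU s" using assms(4) FU_subset by blast
qed

lemma fin_collections_in_subset: "s \<in> fin_collections_in D \<Longrightarrow> t \<subseteq> s \<Longrightarrow> t \<in> fin_collections_in D"
  unfolding fin_collections_in_iff using collection_subset finite_subset by blast

lemma fin_collections_in_finite_Union: "s \<in> fin_collections_in D \<Longrightarrow> finite (\<Union>s)"
  by (auto simp: fin_collections_in_iff collection_def finsets_def)

lemma fin_collections_in_insert:
  assumes "s \<in> fin_collections_in D" "inf_collection D" "t \<in> FU D" "\<And>x. x \<in> s \<Longrightarrow> x \<lless> t"
  shows "insert t s \<in> fin_collections_in D"
  using assms inf_collection_FU_finsets[OF assms(2)] collection_insert_last[of s t]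
  by (auto simp: fin_collections_in_iff)

section \<open>Basic properties of derivatives\<close>

lemma derived_zero: "derived D G 0 = G \<inter> fin_collections_in D"
  by (simp add: derived_def transrec_zero)

lemma derived_osucc: "derived D G (osucc \<xi>) = derived1 D (derived D G \<xi>)"
  by (simp add: derived_def transrec_osucc)

lemma derived_limit: "is_limit \<xi> \<Longrightarrow> derived D G \<xi> = (\<Inter>\<beta><\<xi>. derived D G \<beta>)"
  by (simp add: derived_def transrec_limit)

definition small_exceptions :: "nat set set \<Rightarrow> nat set set set \<Rightarrow> nat set set \<Rightarrow> bool" where
  "small_exceptions D G s \<longleftrightarrow> \<not> (\<exists>E. inf_collection E \<and> E \<subseteq> {t \<in> FU D. insert t s \<notin> G})"

lemma small_exceptions_mono:
  "small_exceptions D G s \<Longrightarrow> FU D' \<subseteq> FU D \<Longrightarrow>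
     (\<And>t. t \<in> FU D' \<Longrightarrow> insert t s \<in> G \<Longrightarrow> insert t s' \<in> G') \<Longrightarrow> small_exceptions D' G' s'"
  unfolding small_exceptions_def by blast

text \<open>Unfolds the recursion once and for all: zero, successor and limit stages take the same
  form, which spares later inductions the case distinction. At a limit, the condition for \<beta> is
  caught by the stage \<open>osucc \<beta>\<close>, still below \<xi>.\<close>

lemma mem_derived_iff:
  "s \<in> derived D G \<xi> \<longleftrightarrow>
     s \<in> G \<inter> fin_collections_in D \<and> (\<forall>\<beta><\<xi>. small_exceptions D (derived D G \<beta>) s)"
proof (induction \<xi> rule: less_induct)
  case (less \<xi>)
  show ?case
  proof (cases \<xi> rule: ordinal_cases)
    case zero
    thus ?thesis by (simp add: derived_zero)
  next
    case (succ \<zeta>)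
    have "s \<in> derived D G \<xi> \<longleftrightarrow>
        s \<in> derived D G \<zeta> \<and> s \<in> fin_collections_in D \<and> small_exceptions D (derived D G \<zeta>) s"
      unfolding succ derived_osucc derived1_def small_exceptions_def by blast
    also have "\<dots> \<longleftrightarrow> s \<in> G \<inter> fin_collections_in D \<and>
        (\<forall>\<beta><\<xi>. small_exceptions D (derived D G \<beta>) s)"
      using less[of \<zeta>] unfolding succ less_osucc_iff le_less
      by (auto simp: less_osucc)
    finally show ?thesis .
  next
    case limit
    have "0 < \<xi>" using limit by (simp add: is_limit_def countable_ordinal_gr_zero_iff)
    have "s \<in> derived D G \<xi> \<longleftrightarrow> (\<forall>\<beta><\<xi>. s \<in> derived D G \<beta>)" by (auto simp: derived_limit[OF limit])
    also have "\<dots> \<longleftrightarrow> (\<forall>\<beta><\<xi>. s \<in> G \<inter> fin_collections_in D \<and>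
        (\<forall>\<gamma><\<beta>. small_exceptions D (derived D G \<gamma>) s))"
      using less by simp
    also have "\<dots> \<longleftrightarrow> s \<in> G \<inter> fin_collections_in D \<and>
        (\<forall>\<beta><\<xi>. small_exceptions D (derived D G \<beta>) s)"
      using \<open>0 < \<xi>\<close> osucc_less_limit[OF limit] less_osucc by (meson less_trans)
    finally show ?thesis .
  qed
qed

lemma derived_subset: "derived D G \<xi> \<subseteq> G \<inter> fin_collections_in D"
  using mem_derived_iff by blast

lemma derived_antimono: "\<alpha> \<le> \<beta> \<Longrightarrow> derived D G \<beta> \<subseteq> derived D G \<alpha>"
  by (auto simp: mem_derived_iff[of _ _ _ \<alpha>] mem_derived_iff[of _ _ _ \<beta>])

text \<open>By induction, an exception for \<open>t\<close> is one for the larger \<open>s\<close>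
  too. In particular a derivative is empty as soon as it loses the empty collection.\<close>

lemma derived_subset_closed:
  assumes "F \<subseteq> fin_collections" "hereditary F" "s \<in> derived D F \<xi>" "t \<subseteq> s"
  shows "t \<in> derived D F \<xi>"
  using assms(3,4)
proof (induction \<xi> arbitrary: s t rule: less_induct)
  case (less \<xi>)
  have s: "s \<in> F \<inter> fin_collections_in D" "\<And>\<beta>. \<beta> < \<xi> \<Longrightarrow> small_exceptions D (derived D F \<beta>) s"
    using less.prems(1) mem_derived_iff by blast+
  have "t \<in> F \<inter> fin_collections_in D"
    using s(1) hereditary_subset[OF assms(1,2) _ less.prems(2)]
      fin_collections_in_subset[OF _ less.prems(2)] by blast
  moreover have "small_exceptions D (derived D F \<beta>) t" if "\<beta> < \<xi>" for \<beta>
    using s(2)[OF that] order.refl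
  proof (rule small_exceptions_mono)
    show "insert x t \<in> derived D F \<beta>" if "insert x s \<in> derived D F \<beta>" for x
      using less.IH[OF \<open>\<beta> < \<xi>\<close> that insert_mono] less.prems(2) .
  qed
  ultimately show ?case unfolding mem_derived_iff by blast
qed

text \<open>A smaller collection offers fewer candidates and hence fewer exceptions. This carries
  survival from a collection of large index to a homogeneous one inside it.\<close>

lemma derived_subcollection:
  assumes "D2 \<sqsubset> D1" "s \<in> derived D1 F \<xi>" "s \<in> fin_collections_in D2"
    and F: "F \<subseteq> fin_collections"
  shows "s \<in> derived D2 F \<xi>"
  using assms(2,3)
proof (induction \<xi> arbitrary: s rule: less_induct)
  case (less \<xi>)
  have s: "s \<in> F" "\<And>\<beta>. \<beta> < \<xi> \<Longrightarrow> small_exceptions D1 (derived D1 F \<beta>) s"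
    using less.prems(1) mem_derived_iff by blast+
  have "small_exceptions D2 (derived D2 F \<beta>) s" if \<beta>: "\<beta> < \<xi>" for \<beta>
    using s(2)[OF \<beta>] subcollection_FU[OF assms(1)]
  proof (rule small_exceptions_mono)
    show "insert t s \<in> derived D2 F \<beta>" if "t \<in> FU D2" "insert t s \<in> derived D1 F \<beta>" for t
    proof (rule less.IH[OF \<beta> that(2)])
      have "insert t s \<in> fin_collections" using that(2) derived_subset F by blast
      thus "insert t s \<in> fin_collections_in D2"
        using less.prems(2) that(1) by (simp add: fin_collections_in_def)
    qed
  qed
  thus ?case using s(1) less.prems(2) unfolding mem_derived_iff by blast
qed

section \<open>Block families and survival of derivations\<close>

lemma inf_collection_beyond:
  assumes "inf_collection E" "finite S"
  obtains t where "t \<in> E" "S \<lless> t"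
proof -
  have "infinite (above S E)" using inf_collection_above[OF assms] by (simp add: inf_collection_iff)
  then obtain t where "t \<in> above S E" by (metis ex_in_conv finite.emptyI)
  hence "t \<in> E" "S \<lless> t" by (auto simp: above_def)
  thus thesis by (rule that)
qed

lemma less_Min_of_set_less: "{..m} \<lless> t \<Longrightarrow> t \<in> finsets - {{}} \<Longrightarrow> m < Min t"
  using finsetsD[of t] Min_in[of t] by (auto simp: set_less_def)

lemma blocks_over_insert:
  assumes D: "inf_collection D" and t: "t \<in> FU D" "m < Min t"
    and u: "u \<in> blocks_over (Min t) (quotient_at (Min t) A) D" "\<And>y. y \<in> u \<Longrightarrow> t \<lless> y"
  shows "insert t u \<in> blocks_over m A D"
proof -
  have tf: "t \<in> finsets - {{}}" using t(1) inf_collection_FU_finsets[OF D] by blast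
  have u': "finite u" "collection u" "u \<subseteq> FU D" "\<And>y. y \<in> u \<Longrightarrow> {Min t} \<lless> y"
      "insert (Min t) (Min ` u) \<in> A"
    using u(1) by (auto simp: blocks_over_def fin_collections_in_iff quotient_at_def)
  have "{m} \<lless> y" if "y \<in> u" for y using u'(4)[OF that] t(2) by (auto simp: set_less_def)
  moreover have "{m} \<lless> t"
    using t(2) finsetsD[OF tf] by (auto simp: set_less_def)
  moreover have "collection (insert t u)" using u'(2) tf u(2) by (rule collection_insert_first)
  ultimately show ?thesis
    using u' t(1) by (auto simp: blocks_over_def fin_collections_in_iff)
qed

text \<open>The start \<open>s\<close> is arbitrary because adding a block \<open>t\<close> replaces
  \<open>s\<close> by \<open>insert t s\<close> and \<open>A\<close> by a quotient. By induction
  \<open>insert t s\<close> survives \<open>r (Min t)\<close> derivations; an infinite collection of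
  exceptions at stage \<beta> would contain a \<open>t\<close> so far out that
  \<open>r (Min t)\<close> has reached \<beta>.\<close>

lemma mem_derived_of_blocks:
  assumes "uniform m \<xi> A" and F: "F \<subseteq> fin_collections" "hereditary F" and D: "inf_collection D"
    and "s \<in> fin_collections_in D"
    and "\<And>u. u \<in> blocks_over m A D \<Longrightarrow> \<forall>x\<in>s. \<forall>y\<in>u. x \<lless> y \<Longrightarrow> s \<union> u \<in> F"
  shows "s \<in> derived D F \<xi>"
  using assms(1,5,6)
proof (induction arbitrary: s)
  case (zero m)
  have "{} \<in> blocks_over m {{}} D"
    by (auto simp: blocks_over_def fin_collections_in_iff collection_def)
  from zero(2)[OF this] show ?case using zero(1) by (simp add: derived_zero)
next
  case (step \<xi> A m r)
  have extend: "insert t s \<in> derived D F (r (Min t))" if t: "t \<in> FU D" "\<Union>s \<union> {..m} \<lless> t" for t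
  proof (rule step.IH)
    have tf: "t \<in> finsets - {{}}" using t(1) inf_collection_FU_finsets[OF D] by blast
    have st: "x \<lless> t" if "x \<in> s" for x using t(2) that unfolding set_less_Un set_less_Union_left by blast
    show mt: "m < Min t" using t(2) tf less_Min_of_set_less unfolding set_less_Un by blast
    show "insert t s \<in> fin_collections_in D"
      using step.prems(1) D t(1) st by (rule fin_collections_in_insert)
    show "insert t s \<union> u \<in> F"
      if u: "u \<in> blocks_over (Min t) (quotient_at (Min t) A) D" "\<forall>x\<in>insert t s. \<forall>y\<in>u. x \<lless> y" for u
    proof -
      have "insert t u \<in> blocks_over m A D" using D t(1) mt u by (intro blocks_over_insert) auto
      moreover have "\<forall>x\<in>s. \<forall>y\<in>insert t u. x \<lless> y" using u(2) st by blast
      ultimately have "s \<union> insert t u \<in> F" by (rule step.prems(2))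
      thus ?thesis by simp
    qed
  qed
  have fin: "finite (\<Union>s)" using step.prems(1) by (rule fin_collections_in_finite_Union)
  \<comment> \<open>The hypothesis speaks of \<open>s\<close> only together with a nonempty
    \<open>u\<close>; heredity brings membership down from an extension of \<open>s\<close>.\<close>
  have "s \<in> F"
  proof -
    obtain t where "t \<in> D" "\<Union>s \<union> {..m} \<lless> t"
      by (rule inf_collection_beyond[OF D, of "\<Union>s \<union> {..m}"]) (use fin in auto)
    hence "insert t s \<in> derived D F (r (Min t))" using extend FU_subset by blast
    thus ?thesis using derived_subset hereditary_subset[OF F, of "insert t s" s] by blast
  qed
  moreover have "small_exceptions D (derived D F \<beta>) s" if \<beta>: "\<beta> < \<xi>" for \<beta>
    unfolding small_exceptions_def
  proof clarify
    fix E assume E: "inf_collection E" "E \<subseteq> {t \<in> FU D. insert t s \<notin> derived D F \<beta>}"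
    obtain N where N: "\<And>n. n > N \<Longrightarrow> \<beta> \<le> r n" using step.hyps(5)[OF \<beta>] by blast
    \<comment> \<open>Beyond \<open>m\<close> the induction hypothesis applies, and beyond
      \<open>N\<close> the rank has reached \<beta>.\<close>
    obtain t where t: "t \<in> E" "\<Union>s \<union> {..max m N} \<lless> t"
      by (rule inf_collection_beyond[OF E(1), of "\<Union>s \<union> {..max m N}"]) (use fin in auto)
    have tf: "t \<in> finsets - {{}}" using t(1) inf_collection_finsets[OF E(1)] by blast
    have "{..max m N} = {..m} \<union> {..N}" by auto
    hence "\<Union>s \<union> {..m} \<lless> t" "{..N} \<lless> t" using t(2) by (simp_all only: set_less_Un)
    hence "insert t s \<in> derived D F (r (Min t))" "\<beta> \<le> r (Min t)"
      using extend E(2) t(1) N less_Min_of_set_less[OF _ tf] by blast+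
    hence "insert t s \<in> derived D F \<beta>" using derived_antimono by blast
    thus False using E(2) t(1) by blast
  qed
  ultimately show ?case using step.prems(1) unfolding mem_derived_iff by blast
qed

text \<open>Every block \<open>t\<close> of \<open>D\<close> beyond \<open>s\<close> and
  \<open>m\<close> is an exception at stage \<xi>, because \<open>insert t s\<close> is gone by
  stage \<open>osucc (r (Min t)) \<le> \<xi>\<close>. For a limit \<xi> these stages are unbounded
  below it, so the exceptions are collected only at \<xi> and \<open>s\<close> goes one step
  later.\<close>

lemma not_mem_derived_of_blocks:
  assumes "uniform m \<xi> A" and D: "inf_collection D"
    and "\<And>u. u \<in> blocks_over m A D \<Longrightarrow> \<forall>x\<in>s. \<forall>y\<in>u. x \<lless> y \<Longrightarrow> s \<union> u \<notin> F"
  shows "s \<notin> derived D F (osucc \<xi>)"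
  using assms(1,3)
proof (induction arbitrary: s)
  case (zero m)
  have "{} \<in> blocks_over m {{}} D"
    by (auto simp: blocks_over_def fin_collections_in_iff collection_def)
  from zero[OF this] show ?case using derived_subset by auto
next
  case (step \<xi> A m r)
  show ?case
  proof
    assume s: "s \<in> derived D F (osucc \<xi>)"
    hence "s \<in> fin_collections_in D" using derived_subset by blast
    hence "finite (\<Union>s \<union> {..m})" using fin_collections_in_finite_Union by auto
    hence E: "inf_collection (above (\<Union>s \<union> {..m}) D)" by (rule inf_collection_above[OF D])
    have "insert t s \<notin> derived D F \<xi>" if "t \<in> above (\<Union>s \<union> {..m}) D" for t
    proof -
      have t: "t \<in> FU D" "\<Union>s \<union> {..m} \<lless> t" using that FU_subset by (auto simp: above_def)
      have tf: "t \<in> finsets - {{}}" using t(1) inf_collection_FU_finsets[OF D] by blast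
      have st: "x \<lless> t" if "x \<in> s" for x
        using t(2) that unfolding set_less_Un set_less_Union_left by blast
      have mt: "m < Min t" using t(2) tf less_Min_of_set_less unfolding set_less_Un by blast
      have "insert t s \<notin> derived D F (osucc (r (Min t)))"
      proof (rule step.IH[OF mt])
        show "insert t s \<union> u \<notin> F"
          if u: "u \<in> blocks_over (Min t) (quotient_at (Min t) A) D" "\<forall>x\<in>insert t s. \<forall>y\<in>u. x \<lless> y" for u
        proof -
          have "insert t u \<in> blocks_over m A D" using D t(1) mt u by (intro blocks_over_insert) auto
          moreover have "\<forall>x\<in>s. \<forall>y\<in>insert t u. x \<lless> y" using u(2) st by blast
          ultimately have "s \<union> insert t u \<notin> F" by (rule step.prems)
          thus ?thesis by simp
        qed
      qed
      moreover have "osucc (r (Min t)) \<le> \<xi>" using step.hyps(3)[OF mt] by (simp add: osucc_le_iff)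
      ultimately show ?thesis using derived_antimono by blast
    qed
    moreover have "above (\<Union>s \<union> {..m}) D \<subseteq> FU D" using FU_subset by (auto simp: above_def)
    ultimately have "\<not> small_exceptions D (derived D F \<xi>) s"
      unfolding small_exceptions_def using E by blast
    thus False using s less_osucc unfolding mem_derived_iff[of s D F "osucc \<xi>"] by blast
  qed
qed

section \<open>Pointwise closedness\<close>

lemma char_fun_eqD:
  "char_fun C = char_fun C' \<Longrightarrow> C \<subseteq> finsets \<Longrightarrow> C' \<subseteq> finsets \<Longrightarrow> C = C'"
  unfolding char_fun_def fun_eq_iff restrict_def by (metis subsetD subset_antisym subsetI)

text \<open>A point of the closure is the characteristic function of a set all of whose finite
  subsets belong to \<open>G\<close>. If that set is finite it is a member itself, so only an
  infinite one can violate closedness.\<close>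

lemma pointwise_closed_iff:
  assumes fin: "\<And>g. g \<in> G \<Longrightarrow> finite g \<and> g \<subseteq> finsets"
    and sub: "\<And>g u. g \<in> G \<Longrightarrow> u \<subseteq> g \<Longrightarrow> u \<in> G"
  shows "pointwise_closed G \<longleftrightarrow> \<not> (\<exists>C. infinite C \<and> C \<subseteq> finsets \<and> (\<forall>u. finite u \<longrightarrow> u \<subseteq> C \<longrightarrow> u \<in> G))"
proof -
  let ?X = "product_topology (\<lambda>_. discrete_topology (UNIV :: bool set)) finsets"
  have top: "topspace ?X = (\<Pi>\<^sub>E i\<in>finsets. UNIV)" by simp
  have char_top: "char_fun C \<in> topspace ?X" for C unfolding top char_fun_def by auto
  have closed_iff: "pointwise_closed G \<longleftrightarrow> openin ?X (topspace ?X - char_fun ` G)"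
    unfolding pointwise_closed_def closedin_def using char_top by blast
  have open_iff: "openin ?X S \<longleftrightarrow> (\<forall>x\<in>S. \<exists>U. finite {i \<in> finsets. U i \<noteq> UNIV} \<and>
      x \<in> Pi\<^sub>E finsets U \<and> Pi\<^sub>E finsets U \<subseteq> S)" for S
    unfolding openin_product_topology_alt by simp
  show ?thesis
  proof
    assume "pointwise_closed G"
    hence op: "openin ?X (topspace ?X - char_fun ` G)" by (simp add: closed_iff)
    show "\<not> (\<exists>C. infinite C \<and> C \<subseteq> finsets \<and> (\<forall>u. finite u \<longrightarrow> u \<subseteq> C \<longrightarrow> u \<in> G))"
    proof clarify
      fix C assume C: "infinite C" "C \<subseteq> finsets" "\<forall>u. finite u \<longrightarrow> u \<subseteq> C \<longrightarrow> u \<in> G"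
      have "char_fun C \<notin> char_fun ` G" using C fin char_fun_eqD by (metis imageE)
      hence mem: "char_fun C \<in> topspace ?X - char_fun ` G" using char_top by blast
      obtain U where U: "finite {i \<in> finsets. U i \<noteq> UNIV}" "char_fun C \<in> Pi\<^sub>E finsets U"
        "Pi\<^sub>E finsets U \<subseteq> topspace ?X - char_fun ` G"
        using bspec[OF op[unfolded open_iff] mem] by blast
      \<comment> \<open>A basic neighbourhood restricts finitely many coordinates, and on these
        \<open>C\<close> agrees with its finite trace \<open>u\<close>.\<close>
      define u where "u = C \<inter> {i \<in> finsets. U i \<noteq> UNIV}"
      have "u \<in> G" using C(3) U(1) by (auto simp: u_def)
      moreover have "char_fun u \<in> Pi\<^sub>E finsets U"
      proof (rule PiE_I)
        show "char_fun u i \<in> U i" if "i \<in> finsets" for i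
          using that PiE_mem[OF U(2) that] by (cases "U i = UNIV") (auto simp: char_fun_def u_def)
      qed (auto simp: char_fun_def)
      ultimately show False using U(3) by blast
    qed
  next
    assume no: "\<not> (\<exists>C. infinite C \<and> C \<subseteq> finsets \<and> (\<forall>u. finite u \<longrightarrow> u \<subseteq> C \<longrightarrow> u \<in> G))"
    show "pointwise_closed G"
      unfolding closed_iff open_iff
    proof
      fix x assume x: "x \<in> topspace ?X - char_fun ` G"
      define C where "C = {s \<in> finsets. x s}"
      have xC: "x = char_fun C"
        using x unfolding top char_fun_def C_def by (auto simp: fun_eq_iff PiE_def extensional_def)
      \<comment> \<open>If no finite \<open>J\<close> separated \<open>C\<close> from
        \<open>G\<close>, the choice of \<open>J\<close> as a finite \<open>u \<subseteq> C\<close>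
        would put \<open>u\<close> into \<open>G\<close>; then \<open>C\<close> is infinite, against
        the assumption, or a member, against the choice of \<open>x\<close>.\<close>
      have "\<exists>J. finite J \<and> J \<subseteq> finsets \<and> (\<forall>g\<in>G. g \<inter> J \<noteq> C \<inter> J)"
      proof (rule ccontr)
        assume *: "\<not> ?thesis"
        have fG: "u \<in> G" if "finite u" "u \<subseteq> C" for u
        proof -
          have "u \<subseteq> finsets" using that(2) by (auto simp: C_def)
          then obtain g where "g \<in> G" "g \<inter> u = C \<inter> u"
            using *[unfolded not_ex, THEN spec, of u] \<open>finite u\<close> by auto
          thus ?thesis using sub that(2) by blast
        qed
        have "C \<subseteq> finsets" by (auto simp: C_def)
        hence "finite C" using no[unfolded not_ex, THEN spec, of C] fG by auto
        hence "C \<in> G" using fG by simp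
        thus False using x xC by blast
      qed
      then obtain J where J: "finite J" "J \<subseteq> finsets" "\<And>g. g \<in> G \<Longrightarrow> g \<inter> J \<noteq> C \<inter> J" by metis
      define U where "U = (\<lambda>i. if i \<in> J then {x i} else UNIV)"
      have "finite {i \<in> finsets. U i \<noteq> UNIV}"
        by (rule finite_subset[OF _ J(1)]) (auto simp: U_def)
      moreover have "x \<in> Pi\<^sub>E finsets U" using x by (auto simp: U_def PiE_def)
      moreover have "Pi\<^sub>E finsets U \<subseteq> topspace ?X - char_fun ` G"
      proof
        fix y assume y: "y \<in> Pi\<^sub>E finsets U"
        have yJ: "y i = x i" if "i \<in> J" for i
          using PiE_mem[OF y, of i] J(2) that by (auto simp: U_def)
        have "y \<notin> char_fun ` G"
        proof
          assume "y \<in> char_fun ` G"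
          then obtain g where g: "g \<in> G" "y = char_fun g" by blast
          have "i \<in> g \<longleftrightarrow> i \<in> C" if "i \<in> J" for i
            using yJ[OF that] J(2) that unfolding g(2) xC by (auto simp: char_fun_def)
          thus False using J(3)[OF g(1)] by blast
        qed
        thus "y \<in> topspace ?X - char_fun ` G" using y unfolding top PiE_def by auto
      qed
      ultimately show "\<exists>U. finite {i \<in> finsets. U i \<noteq> UNIV} \<and> x \<in> Pi\<^sub>E finsets U \<and>
          Pi\<^sub>E finsets U \<subseteq> topspace ?X - char_fun ` G" by blast
    qed
  qed
qed

lemma pointwise_closed_hereditary_iff:
  assumes "F \<subseteq> fin_collections" "hereditary F"
  shows "pointwise_closed (F \<inter> fin_collections_in D) \<longleftrightarrow> \<not> (\<exists>C. infinite C \<and> C \<subseteq> finsets \<and>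
    (\<forall>u. finite u \<longrightarrow> u \<subseteq> C \<longrightarrow> u \<in> F \<inter> fin_collections_in D))"
proof (rule pointwise_closed_iff)
  show "u \<in> F \<inter> fin_collections_in D" if "g \<in> F \<inter> fin_collections_in D" "u \<subseteq> g" for g u
    using that hereditary_subset[OF assms] fin_collections_in_subset by blast
qed (auto simp: fin_collections_in_iff collection_def)

lemma FU_finite_support:
  assumes "finite s" "s \<subseteq> FU C"
  shows "\<exists>U. finite U \<and> U \<subseteq> C \<and> s \<subseteq> FU U"
  using assms
proof (induction s)
  case (insert x s)
  then obtain U where U: "finite U" "U \<subseteq> C" "s \<subseteq> FU U" by auto
  obtain T where T: "x = \<Union>T" "T \<subseteq> C" "finite T" "T \<noteq> {}" using insert.prems unfolding FU_def by blast
  have "x \<in> FU (U \<union> T)" using T unfolding FU_def by blast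
  moreover have "s \<subseteq> FU (U \<union> T)" using U(3) FU_mono[of U "U \<union> T"] by blast
  ultimately show ?case using U T by (intro exI[of _ "U \<union> T"]) auto
qed auto

text \<open>Two-element subsets of \<open>C\<close> are collections, so any two members are
  comparable and \<open>C\<close> is itself a collection. A finite collection of unions involves
  finitely many members of \<open>C\<close>; these form an element of \<open>F\<close>, and heredity
  applies.\<close>

lemma infinite_chain_collection:
  assumes D: "inf_collection D" and F: "F \<subseteq> fin_collections" "hereditary F"
    and C: "infinite C" "\<And>u. finite u \<Longrightarrow> u \<subseteq> C \<Longrightarrow> u \<in> F \<inter> fin_collections_in D"
  shows "C \<sqsubset> D" "fin_collections_in C \<subseteq> F"
proof -
  have "collection C"
    unfolding collection_def
  proof (intro conjI ballI impI)
    show "C \<subseteq> finsets - {{}}"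
    proof
      fix x assume "x \<in> C"
      hence "{x} \<in> fin_collections_in D" using C(2)[of "{x}"] by auto
      thus "x \<in> finsets - {{}}" by (auto simp: fin_collections_in_iff collection_def)
    qed
    fix s t assume "s \<in> C" "t \<in> C" "s \<noteq> t"
    moreover from this have "{s, t} \<in> fin_collections_in D" using C(2)[of "{s, t}"] by auto
    ultimately show "s \<lless> t \<or> t \<lless> s" by (auto simp: fin_collections_in_iff collection_def)
  qed
  moreover have "C \<subseteq> FU D"
  proof
    fix x assume "x \<in> C"
    hence "{x} \<in> fin_collections_in D" using C(2)[of "{x}"] by auto
    thus "x \<in> FU D" by (simp add: fin_collections_in_iff)
  qed
  ultimately show "C \<sqsubset> D" using C(1) D unfolding subcollection_def by (simp add: inf_collection_iff)
  show "fin_collections_in C \<subseteq> F"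
  proof
    fix s assume s: "s \<in> fin_collections_in C"
    hence "finite s" "s \<subseteq> FU C" by (auto simp: fin_collections_in_iff)
    then obtain U where "finite U" "U \<subseteq> C" "s \<subseteq> FU U" using FU_finite_support[of s C] by metis
    moreover have "s \<in> fin_collections" using s by (simp add: fin_collections_in_def)
    ultimately show "s \<in> F" using hereditaryD[OF F(2)] C(2) by blast
  qed
qed

text \<open>The union of an infinite chain of extensions would be an infinite set with all finite
  subsets in \<open>G\<close>. Extensions are proper because a nonempty \<open>t\<close> is not
  beyond itself.\<close>

lemma wf_extensions:
  assumes fin: "\<And>g. g \<in> G \<Longrightarrow> finite g \<and> collection g"
    and sub: "\<And>g u. g \<in> G \<Longrightarrow> u \<subseteq> g \<Longrightarrow> u \<in> G"
    and no: "\<not> (\<exists>C. infinite C \<and> C \<subseteq> finsets \<and> (\<forall>u. finite u \<longrightarrow> u \<subseteq> C \<longrightarrow> u \<in> G))"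
  shows "wf {(u, s). \<exists>t. u = insert t s \<and> u \<in> G \<and> (\<forall>x\<in>s. x \<lless> t)}"
  unfolding wf_iff_no_infinite_down_chain
proof clarify
  fix f :: "nat \<Rightarrow> nat set set"
  assume "\<forall>i. (f (Suc i), f i) \<in> {(u, s). \<exists>t. u = insert t s \<and> u \<in> G \<and> (\<forall>x\<in>s. x \<lless> t)}"
  hence f: "\<exists>t. f (Suc i) = insert t (f i) \<and> f (Suc i) \<in> G \<and> (\<forall>x\<in>f i. x \<lless> t)" for i by simp
  have psub: "f i \<subset> f (Suc i)" for i
  proof -
    obtain t where t: "f (Suc i) = insert t (f i)" "f (Suc i) \<in> G" "\<forall>x\<in>f i. x \<lless> t"
      using f by blast
    have "t \<noteq> {}" using fin[OF t(2)] t(1) by (auto simp: collection_def)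
    hence "t \<notin> f i" using t(3) set_less_irrefl by blast
    thus ?thesis using t(1) by blast
  qed
  have mono: "f i \<subseteq> f j" if "i \<le> j" for i j
    by (rule lift_Suc_mono_le[of f, OF _ that]) (use psub in auto)
  have fG: "f i \<in> G" for i
  proof -
    have "f (Suc i) \<in> G" using f[of i] by auto
    thus ?thesis using sub psub[of i] by blast
  qed
  have "infinite (\<Union>i. f i)"
  proof
    assume fin': "finite (\<Union>i. f i)"
    have "i \<le> card (f i)" for i
    proof (induction i)
      case (Suc i)
      have "card (f i) < card (f (Suc i))" using psub fin[OF fG] by (intro psubset_card_mono) auto
      thus ?case using Suc by simp
    qed simp
    hence "Suc (card (\<Union>i. f i)) \<le> card (f (Suc (card (\<Union>i. f i))))" by blast
    also have "\<dots> \<le> card (\<Union>i. f i)" using fin' by (intro card_mono) auto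
    finally show False by simp
  qed
  moreover have "(\<Union>i. f i) \<subseteq> finsets" using fin[OF fG] by (auto simp: collection_def)
  moreover have "u \<in> G" if u: "finite u" "u \<subseteq> (\<Union>i. f i)" for u
  proof -
    have "\<exists>i. u \<subseteq> f i" using u
    proof (induction u)
      case (insert x u)
      then obtain i j where "u \<subseteq> f i" "x \<in> f j" by auto
      hence "insert x u \<subseteq> f (max i j)" using mono[of i "max i j"] mono[of j "max i j"] by auto
      thus ?case by blast
    qed auto
    thus ?thesis using fG sub by blast
  qed
  ultimately show False using no by blast
qed

lemma countable_finsets: "countable finsets"
  by (rule countable_subset[OF _ countable_Collect_finite]) (auto simp: finsets_def)

text \<open>Well-founded induction gives each \<open>s\<close> a stage at which it is gone over all
  \<open>D1\<close> simultaneously, and this uniformity is what bounds the supremum. The stage is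
  taken beyond those of the extensions \<open>insert t s\<close>, of which there are only countably
  many since \<open>finsets\<close> is countable; then all blocks of \<open>D1\<close> beyond
  \<open>s\<close> are exceptions.\<close>

lemma derived_uniformly_empty:
  assumes F: "F \<subseteq> fin_collections" "hereditary F"
    and closed: "pointwise_closed (F \<inter> fin_collections_in D)"
  shows "\<exists>\<xi>. \<forall>D1. D1 \<sqsubset> D \<longrightarrow> derived D1 F \<xi> = {}"
proof -
  let ?G = "F \<inter> fin_collections_in D"
  let ?R = "{(u, s). \<exists>t. u = insert t s \<and> u \<in> ?G \<and> (\<forall>x\<in>s. x \<lless> t)}"
  have "wf ?R"
  proof (rule wf_extensions)
    show "u \<in> ?G" if "g \<in> ?G" "u \<subseteq> g" for g u
      using that hereditary_subset[OF F] fin_collections_in_subset by blast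
    show "\<not> (\<exists>C. infinite C \<and> C \<subseteq> finsets \<and> (\<forall>u. finite u \<longrightarrow> u \<subseteq> C \<longrightarrow> u \<in> ?G))"
      using closed pointwise_closed_hereditary_iff[OF F] by blast
  qed (auto simp: fin_collections_in_iff)
  hence "\<exists>\<xi>. \<forall>D1. D1 \<sqsubset> D \<longrightarrow> s \<notin> derived D1 F \<xi>" for s
  proof (induction s rule: wf_induct_rule)
    case (less s)
    define T where "T = {t. (insert t s, s) \<in> ?R}"
    have "\<forall>t\<in>T. \<exists>\<xi>. \<forall>D1. D1 \<sqsubset> D \<longrightarrow> insert t s \<notin> derived D1 F \<xi>"
    proof
      fix t assume "t \<in> T"
      from CollectD[OF this[unfolded T_def]]
      show "\<exists>\<xi>. \<forall>D1. D1 \<sqsubset> D \<longrightarrow> insert t s \<notin> derived D1 F \<xi>" by (rule less.IH)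
    qed
    then obtain h where h: "\<And>t D1. t \<in> T \<Longrightarrow> D1 \<sqsubset> D \<Longrightarrow> insert t s \<notin> derived D1 F (h t)"
      by metis
    have "countable T"
    proof (rule countable_subset[OF _ countable_finsets])
      show "T \<subseteq> finsets"
      proof
        fix t assume "t \<in> T"
        hence "insert t s \<in> fin_collections_in D" unfolding T_def by blast
        thus "t \<in> finsets" by (simp add: fin_collections_in_iff collection_def)
      qed
    qed
    then obtain \<xi> where \<xi>: "\<And>t. t \<in> T \<Longrightarrow> h t < \<xi>"
      using countable_imp_bounded[of "h ` T"] by auto
    have "s \<notin> derived D1 F (osucc \<xi>)" if D1: "D1 \<sqsubset> D" for D1
    proof
      assume s: "s \<in> derived D1 F (osucc \<xi>)"
      have D1': "inf_collection D1" using D1 by (rule subcollection_inf)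
      have "s \<in> fin_collections_in D1" using s derived_subset by blast
      hence E: "inf_collection (above (\<Union>s) D1)"
        using inf_collection_above[OF D1'] fin_collections_in_finite_Union by blast
      have "insert t s \<notin> derived D1 F \<xi>" if t: "t \<in> above (\<Union>s) D1" for t
      proof
        assume ts: "insert t s \<in> derived D1 F \<xi>"
        hence "insert t s \<in> ?G" using derived_subset fin_collections_in_mono[OF D1] by blast
        moreover have "\<forall>x\<in>s. x \<lless> t" using t by (simp add: above_def set_less_Union_left)
        ultimately have "t \<in> T" unfolding T_def by auto
        hence "insert t s \<notin> derived D1 F (h t)" "h t \<le> \<xi>" using h[OF _ D1] \<xi> less_imp_le by blast+
        thus False using ts derived_antimono by blast
      qed
      moreover have "above (\<Union>s) D1 \<subseteq> FU D1" using FU_subset by (auto simp: above_def)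
      ultimately have "\<not> small_exceptions D1 (derived D1 F \<xi>) s"
        unfolding small_exceptions_def using E by blast
      thus False using s less_osucc unfolding mem_derived_iff[of s D1 F "osucc \<xi>"] by blast
    qed
    thus ?case by blast
  qed
  then obtain \<xi> where \<xi>: "\<And>D1. D1 \<sqsubset> D \<Longrightarrow> {} \<notin> derived D1 F \<xi>" by blast
  have "derived D1 F \<xi> = {}" if "D1 \<sqsubset> D" for D1
    using \<xi>[OF that] derived_subset_closed[OF F] by (metis empty_subsetI ex_in_conv)
  thus ?thesis by blast
qed

section \<open>The main theorem\<close>

text \<open>Prepares the reformulation by initial segments. The arbitrary \<open>N\<close> allows
  new elements to be placed beyond whole blocks and not only beyond their minima; the first
  alternative speaks of subsets, matching the closure of \<open>F\<close> under
  subcollections.\<close>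

lemma uniform_initial_or_extension:
  assumes "uniform m \<xi> A" "finite p" "{m} \<lless> p"
  shows "(\<exists>q\<subseteq>p. q \<in> A) \<or> (\<forall>N. \<exists>b. finite b \<and> {N} \<lless> b \<and> p \<union> b \<in> A)"
  using assms
proof (induction arbitrary: p)
  case (step \<xi> A m r)
  show ?case
  proof (cases "p = {}")
    case True
    have "\<exists>b. finite b \<and> {N} \<lless> b \<and> b \<in> A" for N
    proof -
      define n where "n = Suc (max m N)"
      have n: "m < n" "N < n" by (auto simp: n_def)
      have "(\<exists>q\<subseteq>{}. q \<in> quotient_at n A) \<or>
          (\<forall>N. \<exists>b. finite b \<and> {N} \<lless> b \<and> {} \<union> b \<in> quotient_at n A)"
        by (rule step.IH[OF n(1)]) auto
      then obtain b where "finite b" "b \<in> quotient_at n A" by auto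
      hence "finite (insert n b)" "insert n b \<in> A" "{N} \<lless> insert n b"
        using n(2) by (auto simp: quotient_at_def set_less_def)
      thus ?thesis by blast
    qed
    thus ?thesis using True by simp
  next
    case False
    define n where "n = Min p"
    have n: "n \<in> p" "\<And>k. k \<in> p \<Longrightarrow> n \<le> k" using False step.prems(1) by (auto simp: n_def)
    have p: "p = insert n (p - {n})" using n(1) by blast
    have "m < n" using step.prems(2) n(1) by (auto simp: set_less_def)
    moreover have "{n} \<lless> p - {n}" using n(2) by (auto simp: set_less_def le_less)
    ultimately have "(\<exists>q\<subseteq>p - {n}. q \<in> quotient_at n A) \<or>
        (\<forall>N. \<exists>b. finite b \<and> {N} \<lless> b \<and> (p - {n}) \<union> b \<in> quotient_at n A)"
      using step.prems(1) by (intro step.IH) auto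
    thus ?thesis
    proof
      assume "\<exists>q\<subseteq>p - {n}. q \<in> quotient_at n A"
      then obtain q where "q \<subseteq> p - {n}" "insert n q \<in> A" by (auto simp: quotient_at_def)
      thus ?thesis using n(1) by (intro disjI1 exI[of _ "insert n q"]) auto
    next
      assume *: "\<forall>N. \<exists>b. finite b \<and> {N} \<lless> b \<and> (p - {n}) \<union> b \<in> quotient_at n A"
      have "\<exists>b. finite b \<and> {N} \<lless> b \<and> p \<union> b \<in> A" for N
      proof -
        obtain b where b: "finite b" "{N} \<lless> b" "insert n ((p - {n}) \<union> b) \<in> A"
          using * by (auto simp: quotient_at_def)
        have "insert n ((p - {n}) \<union> b) = p \<union> b" using n(1) by blast
        thus ?thesis using b by metis
      qed
      thus ?thesis by blast
    qed
  qed
qed auto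

lemma initial_segment_Un:
  assumes "s \<in> fin_collections" "u \<in> fin_collections" "\<And>x y. x \<in> s \<Longrightarrow> y \<in> u \<Longrightarrow> x \<lless> y"
  shows "initial_segment s (s \<union> u)" "s \<union> u \<in> fin_collections"
proof -
  obtain ss us where l: "s = set ss" "disjoint_tuple ss" "u = set us" "disjoint_tuple us"
    using assms(1,2) unfolding fin_collections_def by blast
  have "disjoint_tuple (ss @ us)"
    using l assms(3) by (auto simp: disjoint_tuple_def sorted_wrt_append)
  moreover have "s \<union> u = set (ss @ us)" "s = set (take (length ss) (ss @ us))" using l by auto
  ultimately show "initial_segment s (s \<union> u)" "s \<union> u \<in> fin_collections"
    unfolding initial_segment_def fin_collections_def by blast+
qed

text \<open>The set of minima extends to a member of \<open>A\<close> by elements beyond all of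
  \<open>s\<close>, and these can be appended as singleton blocks.\<close>

lemma mem_upper_star:
  assumes A: "uniform 0 \<xi> A" and s: "s \<in> fin_collections"
    and no: "\<And>t. t \<subseteq> s \<Longrightarrow> Min ` t \<notin> A"
  shows "s \<in> upper_star {s \<in> fin_collections. Min ` s \<in> A}"
proof -
  have s': "finite s" "collection s" using s by (auto simp: fin_collections_iff)
  have fs: "x \<in> finsets - {{}}" if "x \<in> s" for x using that s'(2) by (auto simp: collection_def)
  have "0 < Min x" if "x \<in> s" for x
    using Min_in[of x] fs[OF that] by (auto simp: finsets_def)
  hence "{0} \<lless> Min ` s" by (auto simp: set_less_def)
  moreover have "\<not> (\<exists>q\<subseteq>Min ` s. q \<in> A)" using no by (metis subset_image_iff)
  ultimately have ext: "\<exists>b. finite b \<and> {N} \<lless> b \<and> Min ` s \<union> b \<in> A" for N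
    using uniform_initial_or_extension[OF A, of "Min ` s"] s'(1) by blast
  have fin: "finite (\<Union>s)" using s'(1) fs finsetsD by auto
  \<comment> \<open>Inserting 0 gives \<open>Max\<close> a value when \<open>s\<close> is empty and
    makes all elements of \<open>b\<close> positive.\<close>
  obtain b where b: "finite b" "{Max (insert 0 (\<Union>s))} \<lless> b" "Min ` s \<union> b \<in> A" using ext by blast
  define u where "u = (\<lambda>k. {k}) ` b"
  have pos: "0 < k" if "k \<in> b" for k using b(2) that by (auto simp: set_less_def)
  have "u \<in> fin_collections"
    unfolding fin_collections_iff collection_def u_def finsets_def
    using b(1) pos by (auto simp: set_less_def Suc_le_eq)
  moreover have "x \<lless> y" if "x \<in> s" and y: "y \<in> u" for x y
  proof -
    obtain k where k: "y = {k}" "k \<in> b" using y by (auto simp: u_def)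
    have "i \<le> Max (insert 0 (\<Union>s))" if "i \<in> x" for i
      using that \<open>x \<in> s\<close> fin by (intro Max_ge) auto
    thus ?thesis using b(2) k unfolding set_less_def by (metis le_less_trans singletonD singletonI)
  qed
  ultimately have "initial_segment s (s \<union> u)" "s \<union> u \<in> fin_collections"
    using s initial_segment_Un by blast+
  moreover have "Min ` (s \<union> u) = Min ` s \<union> b" by (auto simp: u_def image_Un image_image)
  ultimately show ?thesis unfolding upper_star_def using b(3) by auto
qed

text \<open>The separate clause for index 0 disappears: there the empty set is the only member of
  the Schreier family, while for positive index uniformity excludes it.\<close>

lemma block_schreier_eq:
  assumes "ladder_system L"
  shows "block_schreier L \<xi> = {s \<in> fin_collections. Min ` s \<in> schreier_family L \<xi>}"
proof (cases "\<xi> = 0")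
  case True
  have "{} \<in> fin_collections" by (simp add: fin_collections_iff collection_def)
  thus ?thesis using True by (auto simp: block_schreier_def schreier_zero_iff)
next
  case False
  hence "{} \<notin> schreier_family L \<xi>"
    using empty_notin_uniform[OF uniform_schreier[OF assms]] by (simp add: countable_ordinal_gr_zero_iff)
  thus ?thesis using False by (auto simp: block_schreier_def)
qed

lemma blocks_over_schreier:
  assumes "ladder_system L"
  shows "blocks_over 0 (schreier_family L \<xi>) D = block_schreier L \<xi> \<inter> fin_collections_in D"
proof -
  have "{0} \<lless> x" if "s \<in> fin_collections_in D" "x \<in> s" for s x
    using that by (auto simp: fin_collections_in_iff collection_def finsets_def set_less_def)
  thus ?thesis unfolding blocks_over_def block_schreier_eq[OF assms]
    by (auto simp: fin_collections_in_def)
qed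

text \<open>For the forward direction, a member of \<open>F\<close> over \<open>D\<close> has no
  subcollection in the block family, since heredity would put that subcollection into
  \<open>F\<close>; so it can be continued to a member of the block family.\<close>

lemma disjoint_iff_upper_star:
  assumes L: "ladder_system L" and F: "F \<subseteq> fin_collections" "hereditary F"
  shows "block_schreier L \<xi> \<inter> fin_collections_in D \<subseteq> fin_collections - F \<longleftrightarrow>
    F \<inter> fin_collections_in D \<subseteq> upper_star (block_schreier L \<xi>) - block_schreier L \<xi>"
proof
  assume *: "block_schreier L \<xi> \<inter> fin_collections_in D \<subseteq> fin_collections - F"
  show "F \<inter> fin_collections_in D \<subseteq> upper_star (block_schreier L \<xi>) - block_schreier L \<xi>"
  proof
    fix s assume s: "s \<in> F \<inter> fin_collections_in D"
    have "Min ` t \<notin> schreier_family L \<xi>" if "t \<subseteq> s" for t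
    proof
      assume "Min ` t \<in> schreier_family L \<xi>"
      moreover have t: "t \<in> F \<inter> fin_collections_in D"
        using s that hereditary_subset[OF F] fin_collections_in_subset by blast
      ultimately have "t \<in> block_schreier L \<xi>"
        using F(1) unfolding block_schreier_eq[OF L] by blast
      thus False using * t by blast
    qed
    hence "s \<in> upper_star (block_schreier L \<xi>)"
      unfolding block_schreier_eq[OF L] using s F(1) by (intro mem_upper_star[OF uniform_schreier[OF L]]) auto
    thus "s \<in> upper_star (block_schreier L \<xi>) - block_schreier L \<xi>" using s * by blast
  qed
qed (auto simp: fin_collections_in_def)

text \<open>\<open>cb_index\<close> is a \<open>LEAST\<close>, informative only once some derivative
  is known to be empty; as derivatives decrease, they stay empty from the index on.\<close>

lemma derived_empty_iff_cb_index:
  assumes "derived D F \<zeta> = {}"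
  shows "derived D F \<xi> = {} \<longleftrightarrow> cb_index D F \<le> \<xi>"
proof
  show "cb_index D F \<le> \<xi>" if "derived D F \<xi> = {}"
    unfolding cb_index_def using that by (rule Least_le)
  show "derived D F \<xi> = {}" if "cb_index D F \<le> \<xi>"
    using derived_antimono[OF that, of D F] LeastI[of "\<lambda>\<xi>. derived D F \<xi> = {}", OF assms]
    unfolding cb_index_def by simp
qed

theorem theorem3p1:
  fixes L :: "countable_ordinal \<Rightarrow> nat \<Rightarrow> countable_ordinal"
    and F :: "nat set set set" and D :: "nat set set"
  assumes "ladder_system L"
    and "F \<subseteq> fin_collections" and "hereditary F"
    and "inf_collection D"
  shows "(\<not> pointwise_closed (F \<inter> fin_collections_in D) \<longrightarrow>
            (\<exists>D1. D1 \<sqsubset> D \<and> fin_collections_in D1 \<subseteq> F)) \<and>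
         (pointwise_closed (F \<inter> fin_collections_in D) \<longrightarrow>
            (\<forall>D1. D1 \<sqsubset> D \<longrightarrow> (\<exists>\<xi>. derived D1 F \<xi> = {})) \<and>
            bdd_above {cb_index D1 F | D1. D1 \<sqsubset> D} \<and>
            (\<forall>\<xi> :: countable_ordinal.
               (osucc \<xi> < sup_index D F \<longrightarrow>
                  (\<exists>D2. D2 \<sqsubset> D \<and> block_schreier L \<xi> \<inter> fin_collections_in D2 \<subseteq> F)) \<and>
               (osucc \<xi> > sup_index D F \<longrightarrow>
                  (\<forall>D1. D1 \<sqsubset> D \<longrightarrow>
                     (\<exists>D2. D2 \<sqsubset> D1 \<and>
                        block_schreier L \<xi> \<inter> fin_collections_in D2 \<subseteq> fin_collections - F)) \<and>
                  (\<forall>D2. D2 \<sqsubset> D \<longrightarrow>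
                     (block_schreier L \<xi> \<inter> fin_collections_in D2 \<subseteq> fin_collections - F \<longleftrightarrow>
                      F \<inter> fin_collections_in D2 \<subseteq>
                        upper_star (block_schreier L \<xi>) - block_schreier L \<xi>))) \<and>
               (osucc \<xi> = sup_index D F \<longrightarrow>
                  (\<exists>D2. D2 \<sqsubset> D \<and>
                     (block_schreier L \<xi> \<inter> fin_collections_in D2 \<subseteq> F \<or>
                      block_schreier L \<xi> \<inter> fin_collections_in D2 \<subseteq> fin_collections - F)))))"
proof (intro conjI impI allI)
  note L = assms(1) and F = assms(2,3) and D = assms(4)
  show "\<exists>D1. D1 \<sqsubset> D \<and> fin_collections_in D1 \<subseteq> F"
    if not_closed: "\<not> pointwise_closed (F \<inter> fin_collections_in D)"
  proof -
    obtain C where "infinite C" "\<forall>u. finite u \<longrightarrow> u \<subseteq> C \<longrightarrow> u \<in> F \<inter> fin_collections_in D"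
      using not_closed unfolding pointwise_closed_hereditary_iff[OF F] by blast
    thus ?thesis using infinite_chain_collection[OF D F, of C] by blast
  qed
  assume closed: "pointwise_closed (F \<inter> fin_collections_in D)"
  let ?I = "{cb_index D1 F | D1. D1 \<sqsubset> D}"
  obtain \<zeta> where \<zeta>: "\<And>D1. D1 \<sqsubset> D \<Longrightarrow> derived D1 F \<zeta> = {}"
    using derived_uniformly_empty[OF F closed] by blast
  have index: "derived D1 F \<xi> = {} \<longleftrightarrow> cb_index D1 F \<le> \<xi>" if "D1 \<sqsubset> D" for D1 \<xi>
    using \<zeta>[OF that] by (rule derived_empty_iff_cb_index)
  show "\<exists>\<xi>. derived D1 F \<xi> = {}" if "D1 \<sqsubset> D" for D1 using \<zeta>[OF that] by blast
  have "\<forall>x\<in>?I. x \<le> \<zeta>" using index \<zeta> by auto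
  thus bdd: "bdd_above ?I" by (meson bdd_above.I)
  have ne: "?I \<noteq> {}" using subcollection_refl[OF D] by blast
  have le_sup: "cb_index D1 F \<le> sup_index D F" if "D1 \<sqsubset> D" for D1
    unfolding sup_index_def using that by (intro cSup_upper[OF _ bdd]) blast
  fix \<xi>
  let ?B = "\<lambda>D. block_schreier L \<xi> \<inter> fin_collections_in D"
  note unif = uniform_schreier[OF L, of \<xi>]
  have Ramsey: "\<exists>D2. D2 \<sqsubset> D1 \<and> (?B D2 \<subseteq> F \<or> ?B D2 \<subseteq> fin_collections - F)"
    if D1: "D1 \<sqsubset> D" for D1
  proof -
    obtain D2 where "D2 \<sqsubset> D1" "?B D2 \<subseteq> F \<or> ?B D2 \<inter> F = {}"
      using block_Ramsey[OF unif subcollection_inf[OF D1]] unfolding blocks_over_schreier[OF L]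
      by blast
    thus ?thesis by (auto simp: fin_collections_in_def)
  qed
  \<comment> \<open>Alternative (iii) is the Ramsey dichotomy over \<open>D\<close> itself.\<close>
  show "\<exists>D2. D2 \<sqsubset> D \<and> (?B D2 \<subseteq> F \<or> ?B D2 \<subseteq> fin_collections - F)"
    by (rule Ramsey[OF subcollection_refl[OF D]])
  show "?B D2 \<subseteq> fin_collections - F \<longleftrightarrow>
      F \<inter> fin_collections_in D2 \<subseteq> upper_star (block_schreier L \<xi>) - block_schreier L \<xi>" for D2
    by (rule disjoint_iff_upper_star[OF L F])
  show "\<exists>D2. D2 \<sqsubset> D \<and> ?B D2 \<subseteq> F" if less: "osucc \<xi> < sup_index D F"
  proof -
    \<comment> \<open>Strict inequality with the supremum yields a collection whose own index
      exceeds \<open>osucc \<xi>\<close>, so the empty collection survives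
      \<open>osucc \<xi>\<close> derivations there and also over every homogeneous \<open>D2\<close>
      inside it.\<close>
    obtain D1 where D1: "D1 \<sqsubset> D" "osucc \<xi> < cb_index D1 F"
      using less unfolding sup_index_def less_cSup_iff[OF ne bdd] by blast
    hence "derived D1 F (osucc \<xi>) \<noteq> {}" by (simp add: index)
    hence empty: "{} \<in> derived D1 F (osucc \<xi>)" using derived_subset_closed[OF F] by blast
    obtain D2 where D2: "D2 \<sqsubset> D1" "?B D2 \<subseteq> F \<or> ?B D2 \<subseteq> fin_collections - F"
      using Ramsey[OF D1(1)] by blast
    have "\<not> ?B D2 \<subseteq> fin_collections - F"
    proof
      assume "?B D2 \<subseteq> fin_collections - F"
      hence "{} \<union> u \<notin> F" if "u \<in> blocks_over 0 (schreier_family L \<xi>) D2" for u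
        using that unfolding blocks_over_schreier[OF L] by auto
      hence "{} \<notin> derived D2 F (osucc \<xi>)"
        using not_mem_derived_of_blocks[OF unif subcollection_inf[OF D2(1)]] by blast
      moreover have "{} \<in> fin_collections_in D2"
        by (simp add: fin_collections_in_iff collection_def)
      ultimately show False using derived_subcollection[OF D2(1) empty _ F(1)] by blast
    qed
    thus ?thesis using D2 D1(1) subcollection_trans by blast
  qed
  show "\<exists>D2. D2 \<sqsubset> D1 \<and> ?B D2 \<subseteq> fin_collections - F"
    if less: "osucc \<xi> > sup_index D F" and D1: "D1 \<sqsubset> D" for D1
  proof -
    obtain D2 where D2: "D2 \<sqsubset> D1" "?B D2 \<subseteq> F \<or> ?B D2 \<subseteq> fin_collections - F"
      using Ramsey[OF D1] by blast
    have D2D: "D2 \<sqsubset> D" using D2(1) D1 by (rule subcollection_trans)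
    \<comment> \<open>Containing the block family would let the empty collection survive \<xi>
      derivations, so the index over \<open>D2\<close>, and with it the supremum, would be at least
      \<open>osucc \<xi>\<close>.\<close>
    have "\<not> ?B D2 \<subseteq> F"
    proof
      assume "?B D2 \<subseteq> F"
      hence "{} \<in> derived D2 F \<xi>"
        using blocks_over_schreier[OF L, of \<xi> D2]
        by (intro mem_derived_of_blocks[OF unif F subcollection_inf[OF D2D]])
          (auto simp: fin_collections_in_iff collection_def)
      hence "\<not> cb_index D2 F \<le> \<xi>" using index[OF D2D] by blast
      thus False using le_sup[OF D2D] less by (simp add: less_osucc_iff)
    qed
    thus ?thesis using D2 by blast
  qed
qed

end
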